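(* Let $(\Omega,\mathcal F,\mathsf P)$ be a probability space, let $\mathcal V^1,\dots,\mathcal V^N$ be non-empty convex, $L^1$-closed, uniformly integrable subsets of $\mathcal P$, let $L_s^1=\bigcap_{n=1}^N L_s^1(\mathcal V^n)$, and let $A$ be a non-empty convex subset of $L_s^1$. If $A$ is a cone and $F\in L_s^1$, then $$\overline V(F)=\sup\Bigl\{\mathsf E_{\mathsf Q}F:\mathsf Q\in\Bigl(\bigcap_{n=1}^N\mathcal V^n\Bigr)\cap\mathcal R\Bigr\},$$ $$\underline V(F)=\inf\Bigl\{\mathsf E_{\mathsf Q}F:\mathsf Q\in\Bigl(\bigcap_{n=1}^N\mathcal V^n\Bigr)\cap\mathcal R\Bigr\}.$$
   Context: $L^0$ is the space of all (real-valued) random variables on $(\Omega,\mathcal F,\mathsf P)$. $\mathcal P$ is the set of probability measures on $(\Omega,\mathcal F)$ absolutely continuous with respect to $\mathsf P$; measures in $\mathcal P$ are identified with their densities with respect to $\mathsf P$, so "$L^1$-closed" and "uniformly integrable" refer to the sets of densities in $L^1(\mathsf P)$. For $\mathsf Q\in\mathcal P$ and $X\in L^0$, the expectation is $\mathsf E_{\mathsf Q}X=\mathsf E_{\mathsf Q}X^+-\mathsf E_{\mathsf Q}X^-$ with the convention $\infty-\infty=-\infty$. For $\mathcal D\subseteq\mathcal P$, $$L_s^1(\mathcal D)=\Bigl\{X\in L^0:\lim_{k\to\infty}\sup_{\mathsf Q\in\mathcal D}\mathsf E_{\mathsf Q}\bigl[|X|\,I(|X|>k)\bigr]=0\Bigr\}.$$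 The set of strictly acceptable opportunities for the $n$-th group is $$\mathcal A^n=\bigl\{X\in L_s^1:\inf_{\mathsf Q\in\mathcal V^n}\mathsf E_{\mathsf Q}X>0\bigr\}.$$ The set of strictly acceptable opportunities (convolution-based) is $$\mathcal A=\Bigl\{X\in L_s^1:\exists X^1,\dots,X^N\in L_s^1\text{ such that }\sum_{n=1}^N X^n=X\text{ and }X^n\in\mathcal A^n\text{ for all }n\Bigr\}.$$ The set of risk-neutral measures is $$\mathcal R=\{\mathsf Q\in\mathcal P:\mathsf E_{\mathsf Q}X\le 0\text{ for any }X\in A\}.$$ For a random variable $F\in L^0$ (the discounted payoff of a contingent claim), the upper and lower prices are $$\overline V(F)=\inf\{x\in\mathbb R:\exists X\in A\text{ such that }X-F+x\in\mathcal A\},$$ $$\underline V(F)=\sup\{x\in\mathbb R:\exists X\in A\text{ such that }X+F-x\in\mathcal A\}.$$ Infima and suprema are taken in $[-\infty,\infty]$, with $\inf\emptyset=+\infty$ and $\sup\emptyset=-\infty$ (the formulas are asserted also when $(\bigcap_n\mathcal V^n)\cap\mathcal R=\emptyset$). *)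

theory Defs
  imports "HOL-Probability.Probability"
begin

text \<open>
  Random variables are represented by measurable functions, not by classes modulo null sets.
  Expectations, acceptability and prices below do not depend on the choice of representatives.
  A set of classes is represented by the set
  of all its representatives; for such a set, the pointwise convexity and cone conditions are
  those of the set of classes.
\<close>

text \<open>Function types carry no \<^class>\<open>real_vector\<close> instance, so the library's \<^const>\<open>convex\<close> does
  not apply to sets of random variables.\<close>

definition convex_rvs :: "('a \<Rightarrow> real) set \<Rightarrow> bool" where
  "convex_rvs D \<longleftrightarrow>
     (\<forall>X\<in>D. \<forall>Y\<in>D. \<forall>u\<ge>0. \<forall>v\<ge>0. u + v = 1 \<longrightarrow> (\<lambda>\<omega>. u * X \<omega> + v * Y \<omega>) \<in> D)"

text \<open>Only strictly positive scalars, so a cone need not contain 0.\<close>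

definition cone_rvs :: "('a \<Rightarrow> real) set \<Rightarrow> bool" where
  "cone_rvs D \<longleftrightarrow> (\<forall>X\<in>D. \<forall>c>0. (\<lambda>\<omega>. c * X \<omega>) \<in> D)"

definition L1_closed :: "'a measure \<Rightarrow> ('a \<Rightarrow> real) set \<Rightarrow> bool" where
  "L1_closed P D \<longleftrightarrow>
     (\<forall>Zs Z. (\<forall>k::nat. Zs k \<in> D) \<longrightarrow> integrable P Z \<longrightarrow>
        (\<lambda>k. \<integral>\<omega>. \<bar>Zs k \<omega> - Z \<omega>\<bar> \<partial>P) \<longlonglongrightarrow> 0 \<longrightarrow> Z \<in> D)"

definition tail_expectation :: "'a measure \<Rightarrow> ('a \<Rightarrow> real) \<Rightarrow> real \<Rightarrow> ennreal" where
  "tail_expectation Q X k = (\<integral>\<^sup>+\<omega>. ennreal \<bar>X \<omega>\<bar> * indicator {\<omega>. \<bar>X \<omega>\<bar> > k} \<omega> \<partial>Q)"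

definition uniformly_integrable :: "'a measure \<Rightarrow> ('a \<Rightarrow> real) set \<Rightarrow> bool" where
  "uniformly_integrable P D \<longleftrightarrow> ((\<lambda>k. SUP Z\<in>D. tail_expectation P Z k) \<longlongrightarrow> 0) at_top"

definition ac_prob_measures :: "'a measure \<Rightarrow> 'a measure set" where
  "ac_prob_measures P = {Q. sets Q = sets P \<and> prob_space Q \<and> absolutely_continuous P Q}"

text \<open>All versions of the densities.  Nonnegativity is required explicitly because \<^const>\<open>ennreal\<close>
  truncates negative values to 0.\<close>

definition densities :: "'a measure \<Rightarrow> 'a measure set \<Rightarrow> ('a \<Rightarrow> real) set" where
  "densities P D =
     {Z. integrable P Z \<and> (AE \<omega> in P. 0 \<le> Z \<omega>) \<and> density P (\<lambda>\<omega>. ennreal (Z \<omega>)) \<in> D}"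

text \<open>The case distinction implements \<open>\<infinity> - \<infinity> = -\<infinity>\<close>; in \<^typ>\<open>ereal\<close>, \<open>\<infinity> - \<infinity>\<close> is \<open>\<infinity>\<close>.\<close>

definition expect :: "'a measure \<Rightarrow> ('a \<Rightarrow> real) \<Rightarrow> ereal" where
  "expect Q X =
     (let p = (\<integral>\<^sup>+\<omega>. ennreal (max 0 (X \<omega>)) \<partial>Q);
          m = (\<integral>\<^sup>+\<omega>. ennreal (max 0 (- X \<omega>)) \<partial>Q)
      in if m = \<infinity> then - \<infinity> else enn2ereal p - enn2ereal m)"

definition Ls1_of :: "'a measure \<Rightarrow> 'a measure set \<Rightarrow> ('a \<Rightarrow> real) set" where
  "Ls1_of P D =
     {X \<in> borel_measurable P. ((\<lambda>k. SUP Q\<in>D. tail_expectation Q X k) \<longlongrightarrow> 0) at_top}"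

definition Ls1 :: "'a measure \<Rightarrow> nat \<Rightarrow> (nat \<Rightarrow> 'a measure set) \<Rightarrow> ('a \<Rightarrow> real) set" where
  "Ls1 P N V = (\<Inter>n\<in>{1..N}. Ls1_of P (V n))"

definition group_acceptable ::
  "'a measure \<Rightarrow> nat \<Rightarrow> (nat \<Rightarrow> 'a measure set) \<Rightarrow> nat \<Rightarrow> ('a \<Rightarrow> real) set" where
  "group_acceptable P N V n = {X \<in> Ls1 P N V. (INF Q\<in>V n. expect Q X) > 0}"

definition acceptable ::
  "'a measure \<Rightarrow> nat \<Rightarrow> (nat \<Rightarrow> 'a measure set) \<Rightarrow> ('a \<Rightarrow> real) set" where
  "acceptable P N V =
     {X \<in> Ls1 P N V. \<exists>Xs :: nat \<Rightarrow> 'a \<Rightarrow> real.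
        (\<forall>n\<in>{1..N}. Xs n \<in> Ls1 P N V) \<and>
        (AE \<omega> in P. (\<Sum>n=1..N. Xs n \<omega>) = X \<omega>) \<and>
        (\<forall>n\<in>{1..N}. Xs n \<in> group_acceptable P N V n)}"

definition risk_neutral :: "'a measure \<Rightarrow> ('a \<Rightarrow> real) set \<Rightarrow> 'a measure set" where
  "risk_neutral P A = {Q \<in> ac_prob_measures P. \<forall>X\<in>A. expect Q X \<le> 0}"

definition upper_price ::
  "'a measure \<Rightarrow> nat \<Rightarrow> (nat \<Rightarrow> 'a measure set) \<Rightarrow> ('a \<Rightarrow> real) set \<Rightarrow> ('a \<Rightarrow> real) \<Rightarrow> ereal" where
  "upper_price P N V A F =
     Inf {ereal x | x. \<exists>X\<in>A. (\<lambda>\<omega>. X \<omega> - F \<omega> + x) \<in> acceptable P N V}"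

definition lower_price ::
  "'a measure \<Rightarrow> nat \<Rightarrow> (nat \<Rightarrow> 'a measure set) \<Rightarrow> ('a \<Rightarrow> real) set \<Rightarrow> ('a \<Rightarrow> real) \<Rightarrow> ereal" where
  "lower_price P N V A F =
     Sup {ereal x | x. \<exists>X\<in>A. (\<lambda>\<omega>. X \<omega> + F \<omega> - x) \<in> acceptable P N V}"

end

theory Submission
  imports Defs
begin

text \<open>
  The weak inequality is immediate: if \<open>Q\<close> lies in every \<open>V n\<close> and is risk-neutral, then every
  acceptable position has strictly positive \<open>Q\<close>-expectation, because its \<open>n\<close>-th part has, so
  \<open>X - F + x\<close> can be acceptable with \<open>X \<in> A\<close> only if \<open>E\<^sub>Q F < x\<close>.

  The converse rests on a separation statement (\<open>no_acceptable_imp_common_measure\<close>): a non-empty convex set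
  \<open>B\<close> of positions without an acceptable element admits a measure common to all \<open>V n\<close> under which every
  element of \<open>B\<close> has non-positive expectation.  If no \<open>X - F + x\<close> with \<open>X \<in> A\<close> is acceptable,
  apply it to the set \<open>B\<close> of these positions.  Since \<open>A\<close> is a cone, \<open>X\<close> may be scaled by large and by
  small \<open>c > 0\<close> in \<open>c E\<^sub>Q X - E\<^sub>Q F + x \<le> 0\<close>, which gives \<open>E\<^sub>Q X \<le> 0\<close> and \<open>x \<le> E\<^sub>Q F\<close>.
  The lower price of \<open>F\<close> is the negative of the upper price of \<open>-F\<close>.

  For the separation statement, consider tuples \<open>z\<close> of densities, \<open>z n\<close> from \<open>V n\<close>, and for each tuple
  \<open>X\<close> of positions with sum in \<open>B\<close> the affine function \<open>z \<mapsto> \<Sum>\<^sub>n E(z n * X n)\<close>.  A tuple \<open>z\<close> at which all these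
  functions are at most \<open>0\<close> solves the problem: adding to one position a multiple of an indicator and
  subtracting it from another does not change the sum of the positions, so all \<open>z n\<close> induce the same measure.
  If there is no such \<open>z\<close>, then

  \<^item> for some \<open>e > 0\<close>, finitely many of the functions have no tuple at which they are all at most \<open>e\<close>;
    this compactness argument is \<open>convex_gauge_finite_intersection\<close>;
  \<^item> therefore a convex combination of these finitely many functions, which again comes from a tuple of
    positions with sum in \<open>B\<close>, is bounded below by a positive constant (\<open>finite_minimax\<close>);
  \<^item> after constants are moved between its components, that tuple of positions shows that its sum is acceptable
    (\<open>acceptable_if_total_expectation_bounded_below\<close>), contrary to the choice of \<open>B\<close>.

  Compactness is obtained without the weak topology of \<open>L\<^sup>1\<close>.  The functional \<open>E (1 / (1 + z))\<close> is
  bounded and, on a uniformly integrable set of densities, uniformly convex with respect to the \<open>L\<^sup>1\<close> distance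
  (\<open>total_gauge_uniformly_convex\<close>).  Hence almost minimizers of it over shrinking convex closed
  sets form a Cauchy sequence, just as in the projection theorem for Hilbert spaces, and convex \<open>L\<^sup>1\<close>-closed
  subsets with the finite intersection property have a common point.
\<close>

section \<open>A minimax theorem for finitely many affine functions\<close>

text \<open>The set of pairs \<open>(f z, g z)\<close> is convex and misses the quadrant \<open>{..c} \<times> {..c}\<close>.  A separating line
has a normal vector with non-negative coordinates, since the quadrant is unbounded in both directions; normalized to
sum \<open>1\<close>, these are the weights.  The domain \<open>K\<close> carries no linear structure: it is enough that convex
combinations of values are again values.\<close>

lemma pair_minimax:
  fixes f g :: "'k \<Rightarrow> real"
  assumes mix: "\<And>z w u v. z \<in> K \<Longrightarrow> w \<in> K \<Longrightarrow> 0 \<le> u \<Longrightarrow> 0 \<le> v \<Longrightarrow> u + v = 1 \<Longrightarrow>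
                  \<exists>y\<in>K. f y = u * f z + v * f w \<and> g y = u * g z + v * g w"
    and max: "\<And>z. z \<in> K \<Longrightarrow> c < f z \<or> c < g z"
  shows "\<exists>u v. 0 \<le> u \<and> 0 \<le> v \<and> u + v = 1 \<and> (\<forall>z\<in>K. c \<le> u * f z + v * g z)"
proof (cases "K = {}")
  case True
  then show ?thesis by (intro exI[of _ 1] exI[of _ 0]) auto
next
  case False
  define T where "T = (\<lambda>z. (f z, g z)) ` K"
  define L where "L = {..c} \<times> {..c}"
  have "convex T"
    unfolding convex_def
  proof (intro ballI allI impI)
    fix x y u v assume "x \<in> T" "y \<in> T" and uv: "(0::real) \<le> u" "0 \<le> v" "u + v = 1"
    then obtain z w where zw: "z \<in> K" "w \<in> K" "x = (f z, g z)" "y = (f w, g w)"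
      unfolding T_def by blast
    from mix[OF zw(1,2) uv] show "u *\<^sub>R x + v *\<^sub>R y \<in> T"
      unfolding T_def zw(3,4) by (auto simp: image_iff intro!: bexI)
  qed
  moreover have "convex L" unfolding L_def by (intro convex_Times) auto
  moreover have "L \<inter> T = {}" unfolding L_def T_def using max by fastforce
  moreover have "L \<noteq> {}" "T \<noteq> {}" unfolding L_def T_def using False by auto
  ultimately obtain a b where ab: "a \<noteq> 0" "\<forall>x\<in>L. inner a x \<le> b" "\<forall>x\<in>T. b \<le> inner a x"
    using separating_hyperplane_sets[of L T] by blast
  obtain p q where a: "a = (p, q)" by (cases a)
  have low: "p * x + q * y \<le> b" if "x \<le> c" "y \<le> c" for x y
    using ab(2) that unfolding a L_def by auto
  have "0 \<le> p"
  proof (rule ccontr)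
    assume neg: "\<not> 0 \<le> p"
    \<comment> \<open>With \<open>p < 0\<close>, this step to the left inside the quadrant pushes the linear form above \<open>b\<close>.\<close>
    define t where "t = (\<bar>b - p * c - q * c\<bar> + 1) / (- p)"
    have "0 \<le> t" "- p * t = \<bar>b - p * c - q * c\<bar> + 1"
      unfolding t_def using neg by (auto simp: field_simps)
    then show False using low[of "c - t" c] by (auto simp: algebra_simps)
  qed
  moreover have "0 \<le> q"
  proof (rule ccontr)
    assume neg: "\<not> 0 \<le> q"
    define t where "t = (\<bar>b - p * c - q * c\<bar> + 1) / (- q)"
    have "0 \<le> t" "- q * t = \<bar>b - p * c - q * c\<bar> + 1"
      unfolding t_def using neg by (auto simp: field_simps)
    then show False using low[of c "c - t"] by (auto simp: algebra_simps)
  qed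
  ultimately have pq: "0 \<le> p" "0 \<le> q" "0 < p + q"
    using ab(1) a by (auto simp: zero_prod_def order_less_le)
  have "c \<le> p / (p + q) * f z + q / (p + q) * g z" if "z \<in> K" for z
  proof -
    have "(p + q) * c \<le> p * f z + q * g z"
      using low[of c c] ab(3) that unfolding a T_def by (auto simp: algebra_simps)
    then have "c \<le> (p * f z + q * g z) / (p + q)"
      using pq by (simp add: pos_le_divide_eq mult.commute)
    then show ?thesis by (simp add: add_divide_distrib)
  qed
  then show ?thesis
    using pq by (intro exI[of _ "p / (p + q)"] exI[of _ "q / (p + q)"])
      (auto simp: add_divide_distrib[symmetric])
qed

text \<open>The functions are merged one at a time.  On the part of \<open>K\<close> where \<open>g \<le> c\<close> one of the remaining functions
exceeds \<open>c\<close>, so by induction some \<open>h\<close> in \<open>G\<close> is bounded below there, and \<open>pair_minimax\<close> combines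
\<open>g\<close> with \<open>h\<close>.  Every merge turns a strict bound into a weak one; the slack between \<open>c'\<close> and \<open>c\<close> restores
strictness for the next merge.\<close>

lemma finite_minimax:
  fixes G :: "('k \<Rightarrow> real) set"
  assumes "finite S" "S \<subseteq> G" "G \<noteq> {}"
    and mixK: "\<And>z w u v. z \<in> K \<Longrightarrow> w \<in> K \<Longrightarrow> 0 \<le> u \<Longrightarrow> 0 \<le> v \<Longrightarrow> u + v = 1 \<Longrightarrow>
                 \<exists>y\<in>K. \<forall>g\<in>G. g y = u * g z + v * g w"
    and mixG: "\<And>f g u v. f \<in> G \<Longrightarrow> g \<in> G \<Longrightarrow> 0 \<le> u \<Longrightarrow> 0 \<le> v \<Longrightarrow> u + v = 1 \<Longrightarrow>
                 \<exists>h\<in>G. \<forall>z\<in>K. h z = u * f z + v * g z"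
    and "\<And>z. z \<in> K \<Longrightarrow> \<exists>g\<in>S. c < g z"
    and "c' < c"
  shows "\<exists>h\<in>G. \<forall>z\<in>K. c' \<le> h z"
  using assms
proof (induction S arbitrary: K c c' rule: finite_induct)
  case empty
  then show ?case by (metis empty_iff equals0I)
next
  case (insert g S)
  let ?K = "{z \<in> K. g z \<le> c}"
  have gG: "g \<in> G" using insert.prems(1) by auto
  have "\<exists>h\<in>G. \<forall>z\<in>?K. (c + c') / 2 \<le> h z"
  proof (rule insert.IH)
    show "\<exists>y\<in>?K. \<forall>g\<in>G. g y = u * g z + v * g w"
      if zw: "z \<in> ?K" "w \<in> ?K" and uv: "0 \<le> u" "0 \<le> v" "u + v = 1" for z w u v
    proof -
      obtain y where y: "y \<in> K" "\<forall>g\<in>G. g y = u * g z + v * g w"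
        using insert.prems(3)[of z w u v] zw uv by auto
      have "u * g z + v * g w \<le> c" using convex_bound_le[of "g z" c "g w" u v] zw uv by auto
      then show ?thesis using y gG by auto
    qed
    show "\<exists>h\<in>G. \<forall>z\<in>?K. h z = u * f z + v * g z"
      if "f \<in> G" "g \<in> G" "0 \<le> u" "0 \<le> v" "u + v = 1" for f g u v
      using insert.prems(4)[OF that] by blast
    show "\<exists>g\<in>S. c < g z" if "z \<in> ?K" for z
      using insert.prems(5)[of z] that by (metis (mono_tags, lifting) insertE mem_Collect_eq not_less)
    show "(c + c') / 2 < c" using insert.prems(6) by simp
    show "S \<subseteq> G" using insert.prems(1) by simp
    show "G \<noteq> {}" by fact
  qed
  then obtain h where h: "h \<in> G" "\<And>z. z \<in> K \<Longrightarrow> g z \<le> c \<Longrightarrow> (c + c') / 2 \<le> h z" by auto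
  have "\<exists>u v. 0 \<le> u \<and> 0 \<le> v \<and> u + v = 1 \<and> (\<forall>z\<in>K. c' \<le> u * g z + v * h z)"
  proof (rule pair_minimax)
    show "\<exists>y\<in>K. g y = u * g z + v * g w \<and> h y = u * h z + v * h w"
      if "z \<in> K" "w \<in> K" "0 \<le> u" "0 \<le> v" "u + v = 1" for z w u v
      using insert.prems(3)[OF that] gG h(1) by blast
    show "c' < g z \<or> c' < h z" if "z \<in> K" for z
      using h(2)[OF that] insert.prems(6) by (cases "g z \<le> c") auto
  qed
  then show ?case using insert.prems(4)[OF gG h(1)] by metis
qed

section \<open>Finite intersections and uniformly convex functionals\<close>

text \<open>A substitute for compactness.  As \<open>\<S>\<close> grows, the infimum of \<open>\<Phi>\<close> over \<open>K \<inter> \<Inter>\<S>\<close> increases to a finite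
supremum \<open>s\<close>.  Along an increasing sequence of finite families whose infima approach \<open>s\<close>, two almost minimizers
have a midpoint in the same set, so \<open>\<Phi>\<close> cannot be much smaller there than \<open>s\<close>, and by uniform convexity
they are close together.  Almost minimizers therefore converge to some \<open>z\<close>.  Almost minimizers that are required in
addition to lie in a given \<open>C\<close> are close to the previous ones, so they converge to the same \<open>z\<close>,
and \<open>z\<close> lies in \<open>C\<close>.\<close>

lemma convex_gauge_finite_intersection:
  fixes d :: "'k \<Rightarrow> 'k \<Rightarrow> real" and \<Phi> :: "'k \<Rightarrow> real" and mid :: "'k \<Rightarrow> 'k \<Rightarrow> 'k"
  assumes d_nonneg: "\<And>x y. 0 \<le> d x y"
    and triangle: "\<And>x y z. x \<in> K \<Longrightarrow> y \<in> K \<Longrightarrow> z \<in> K \<Longrightarrow> d x z \<le> d x y + d y z"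
    and complete: "\<And>zs. (\<forall>k::nat. zs k \<in> K) \<Longrightarrow> (\<forall>e>0. \<exists>k. \<forall>i\<ge>k. \<forall>j\<ge>k. d (zs i) (zs j) < e) \<Longrightarrow>
                     \<exists>z\<in>K. (\<lambda>k. d (zs k) z) \<longlonglongrightarrow> 0"
    and bounds: "\<And>z. z \<in> K \<Longrightarrow> 0 \<le> \<Phi> z" "\<And>z. z \<in> K \<Longrightarrow> \<Phi> z \<le> b"
    and gauge: "\<And>e. 0 < e \<Longrightarrow> \<exists>r>0. \<forall>z\<in>K. \<forall>w\<in>K. (\<Phi> z + \<Phi> w) / 2 - \<Phi> (mid z w) \<le> r \<longrightarrow> d z w < e"
    and midK: "\<And>z w. z \<in> K \<Longrightarrow> w \<in> K \<Longrightarrow> mid z w \<in> K"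
    and midC: "\<And>C z w. C \<in> \<C> \<Longrightarrow> z \<in> K \<inter> C \<Longrightarrow> w \<in> K \<inter> C \<Longrightarrow> mid z w \<in> C"
    and closed: "\<And>C zs z. C \<in> \<C> \<Longrightarrow> (\<forall>k::nat. zs k \<in> K \<inter> C) \<Longrightarrow> z \<in> K \<Longrightarrow> (\<lambda>k. d (zs k) z) \<longlonglongrightarrow> 0 \<Longrightarrow> z \<in> C"
    and fip: "\<And>\<S>. finite \<S> \<Longrightarrow> \<S> \<subseteq> \<C> \<Longrightarrow> K \<inter> \<Inter>\<S> \<noteq> {}"
  shows "\<exists>z\<in>K. \<forall>C\<in>\<C>. z \<in> C"
proof -
  define m where "m \<S> = Inf (\<Phi> ` (K \<inter> \<Inter>\<S>))" for \<S>
  define F where "F = {\<S>. finite \<S> \<and> \<S> \<subseteq> \<C>}"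
  have bddb: "bdd_below (\<Phi> ` (K \<inter> \<Inter>\<S>))" for \<S>
    using bounds(1) by (auto intro!: bdd_belowI[of _ 0])
  have m_le: "m \<S> \<le> \<Phi> z" if "z \<in> K \<inter> \<Inter>\<S>" for \<S> z
    unfolding m_def using that bddb by (intro cInf_lower) auto
  have m_b: "m \<S> \<le> b" if "\<S> \<in> F" for \<S>
    using fip[of \<S>] that m_le[of _ \<S>] bounds(2) unfolding F_def by fastforce
  have m_mono: "m \<S> \<le> m \<T>" if "\<S> \<subseteq> \<T>" "\<T> \<in> F" for \<S> \<T>
  proof -
    have "\<Phi> ` (K \<inter> \<Inter>\<T>) \<subseteq> \<Phi> ` (K \<inter> \<Inter>\<S>)" using that(1) by blast
    moreover have "\<Phi> ` (K \<inter> \<Inter>\<T>) \<noteq> {}" using that(2) fip[of \<T>] by (auto simp: F_def)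
    ultimately show ?thesis unfolding m_def using bddb by (intro cInf_superset_mono)
  qed
  define s where "s = Sup (m ` F)"
  have bdda: "bdd_above (m ` F)" using m_b by (auto intro!: bdd_aboveI[of _ b])
  have m_s: "m \<S> \<le> s" if "\<S> \<in> F" for \<S>
    unfolding s_def using that bdda by (intro cSup_upper) auto
  have "\<exists>\<S>\<in>F. s - inverse (real (Suc k)) < m \<S>" for k
  proof -
    have "m ` F \<noteq> {}" unfolding F_def by auto
    then show ?thesis
      using less_cSupE[of "s - inverse (real (Suc k))" "m ` F"] unfolding s_def[symmetric] by auto
  qed
  then obtain \<S>0 where S0: "\<S>0 k \<in> F" "s - inverse (real (Suc k)) < m (\<S>0 k)" for k by metis
  define \<S> where "\<S> k = (\<Union>j\<le>k. \<S>0 j)" for k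
  have SF: "\<S> k \<in> F" for k using S0(1) unfolding \<S>_def F_def by auto
  have S_mono: "\<S> i \<subseteq> \<S> j" if "i \<le> j" for i j unfolding \<S>_def using that by fastforce
  have S_m: "s - inverse (real (Suc k)) < m (\<S> k)" for k
    using S0(2)[of k] m_mono[of "\<S>0 k" "\<S> k"] SF[of k] unfolding \<S>_def by fastforce
  define near where "near k z \<longleftrightarrow> z \<in> K \<inter> \<Inter>(\<S> k) \<and> \<Phi> z < s + inverse (real (Suc k))" for k z
  \<comment> \<open>An additional finite family keeps the infimum at most \<open>s\<close>, so it still leaves room for an almost minimizer.\<close>
  have near_ex: "\<exists>z. near k z \<and> z \<in> \<Inter>\<T>" if "\<T> \<in> F" for k \<T>
  proof -
    have UF: "\<S> k \<union> \<T> \<in> F" using SF[of k] that unfolding F_def by auto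
    have "\<Phi> ` (K \<inter> \<Inter>(\<S> k \<union> \<T>)) \<noteq> {}" using fip[of "\<S> k \<union> \<T>"] UF unfolding F_def by blast
    moreover have "Inf (\<Phi> ` (K \<inter> \<Inter>(\<S> k \<union> \<T>))) < s + inverse (real (Suc k))"
      using m_s[OF UF] unfolding m_def by (smt (verit) inverse_positive_iff_positive of_nat_0_less_iff zero_less_Suc)
    ultimately show ?thesis
      using cInf_lessD[of "\<Phi> ` (K \<inter> \<Inter>(\<S> k \<union> \<T>))" "s + inverse (real (Suc k))"] unfolding near_def by auto
  qed
  have near_mono: "near i z" if "near j z" "i \<le> j" for i j z
  proof -
    have "inverse (real (Suc j)) \<le> inverse (real (Suc i))" using that(2) by (simp add: field_simps)
    then have "\<Phi> z < s + inverse (real (Suc i))" using that(1) unfolding near_def by linarith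
    moreover have "z \<in> K \<inter> \<Inter>(\<S> i)"
      using that(1) Inter_anti_mono[OF S_mono[OF that(2)]] unfolding near_def by blast
    ultimately show ?thesis unfolding near_def by blast
  qed
  have near_close: "\<exists>k. \<forall>z w. near k z \<longrightarrow> near k w \<longrightarrow> d z w < e" if "0 < e" for e
  proof -
    obtain r where r: "r > 0" "\<And>z w. z \<in> K \<Longrightarrow> w \<in> K \<Longrightarrow> (\<Phi> z + \<Phi> w) / 2 - \<Phi> (mid z w) \<le> r \<Longrightarrow> d z w < e"
      using gauge[OF \<open>0 < e\<close>] by blast
    obtain k where k: "inverse (real (Suc k)) < r / 2"
      using reals_Archimedean[of "r / 2"] r(1) by auto
    have "d z w < e" if "near k z" "near k w" for z w
    proof (rule r(2))
      have "mid z w \<in> K \<inter> \<Inter>(\<S> k)"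
        using that SF[of k] midK[of z w] midC[of _ z w] unfolding near_def F_def by blast
      from m_le[OF this] S_m[of k] have "s - inverse (real (Suc k)) < \<Phi> (mid z w)" by linarith
      moreover have "\<Phi> z < s + inverse (real (Suc k))" "\<Phi> w < s + inverse (real (Suc k))"
        using that unfolding near_def by auto
      moreover define t where "t = inverse (real (Suc k))"
      ultimately show "(\<Phi> z + \<Phi> w) / 2 - \<Phi> (mid z w) \<le> r"
        using k unfolding t_def[symmetric] by (simp add: field_simps)
    qed (use that in \<open>auto simp: near_def\<close>)
    then show ?thesis by blast
  qed
  have "\<exists>z. near k z" for k using near_ex[of "{}" k] by (auto simp: F_def)
  then obtain zs where zs: "near k (zs k)" for k by metis
  have zsK: "zs k \<in> K" for k using zs unfolding near_def by auto
  have "\<exists>k. \<forall>i\<ge>k. \<forall>j\<ge>k. d (zs i) (zs j) < e" if "0 < e" for e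
    using near_close[OF that] zs near_mono by metis
  then obtain z where z: "z \<in> K" "(\<lambda>k. d (zs k) z) \<longlonglongrightarrow> 0" using complete[of zs] zsK by blast
  have "z \<in> C" if C: "C \<in> \<C>" for C
  proof -
    have "\<exists>w. near k w \<and> w \<in> C" for k using near_ex[of "{C}" k] C by (auto simp: F_def)
    then obtain ws where ws: "near k (ws k)" "ws k \<in> C" for k by metis
    have wsK: "ws k \<in> K" for k using ws unfolding near_def by auto
    have wz: "(\<lambda>k. d (ws k) (zs k)) \<longlonglongrightarrow> 0"
    proof (rule LIMSEQ_I)
      fix e :: real assume "0 < e"
      then obtain k where "\<And>z w. near k z \<Longrightarrow> near k w \<Longrightarrow> d z w < e" using near_close by blast
      then have "\<forall>j\<ge>k. norm (d (ws j) (zs j) - 0) < e"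
        using d_nonneg near_mono ws zs by (metis abs_of_nonneg diff_zero real_norm_def)
      then show "\<exists>k. \<forall>j\<ge>k. norm (d (ws j) (zs j) - 0) < e" by blast
    qed
    have "(\<lambda>k. d (ws k) z) \<longlonglongrightarrow> 0"
    proof (rule tendsto_sandwich[of "\<lambda>_. 0" _ _ "\<lambda>k. d (ws k) (zs k) + d (zs k) z"])
      show "(\<lambda>k. d (ws k) (zs k) + d (zs k) z) \<longlonglongrightarrow> 0" using tendsto_add[OF wz z(2)] by simp
      show "\<forall>\<^sub>F k in sequentially. d (ws k) z \<le> d (ws k) (zs k) + d (zs k) z"
        using triangle[OF wsK zsK z(1)] by auto
    qed (use d_nonneg in auto)
    then show ?thesis using closed[OF C] ws wsK z(1) by blast
  qed
  then show ?thesis using z(1) by blast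
qed

section \<open>Uniformly small tails\<close>

lemma uniform_limit_zero_iff:
  fixes f :: "'i \<Rightarrow> real \<Rightarrow> ennreal"
  shows "((\<lambda>k. SUP i\<in>I. f i k) \<longlongrightarrow> 0) at_top \<longleftrightarrow> (\<forall>e>0. \<exists>k0. \<forall>k\<ge>k0. \<forall>i\<in>I. f i k \<le> ennreal e)"
proof
  assume L: "((\<lambda>k. SUP i\<in>I. f i k) \<longlongrightarrow> 0) at_top"
  show "\<forall>e>0. \<exists>k0. \<forall>k\<ge>k0. \<forall>i\<in>I. f i k \<le> ennreal e"
  proof (intro allI impI)
    fix e :: real assume "0 < e"
    then have "\<forall>\<^sub>F k in at_top. (SUP i\<in>I. f i k) < ennreal e" using order_tendstoD(2)[OF L] by auto
    then obtain k0 where "\<forall>k\<ge>k0. (SUP i\<in>I. f i k) < ennreal e" by (auto simp: eventually_at_top_linorder)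
    then show "\<exists>k0. \<forall>k\<ge>k0. \<forall>i\<in>I. f i k \<le> ennreal e"
      by (meson SUP_upper less_imp_le order_trans)
  qed
next
  assume R: "\<forall>e>0. \<exists>k0. \<forall>k\<ge>k0. \<forall>i\<in>I. f i k \<le> ennreal e"
  show "((\<lambda>k. SUP i\<in>I. f i k) \<longlongrightarrow> 0) at_top"
  proof (rule order_tendstoI)
    fix a :: ennreal assume "0 < a"
    then obtain b where b: "0 < b" "b < a" using dense by blast
    then obtain e where e: "b = ennreal e" "0 \<le> e" by (cases b) auto
    then have "0 < e" using b by auto
    then obtain k0 where "\<forall>k\<ge>k0. \<forall>i\<in>I. f i k \<le> ennreal e" using R by blast
    then have "\<forall>k\<ge>k0. (SUP i\<in>I. f i k) < a"
      using b e by (auto intro!: le_less_trans[OF SUP_least])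
    then show "\<forall>\<^sub>F k in at_top. (SUP i\<in>I. f i k) < a" by (auto simp: eventually_at_top_linorder)
  qed auto
qed

lemma Ls1_of_iff:
  "X \<in> Ls1_of P D \<longleftrightarrow> X \<in> borel_measurable P \<and>
     (\<forall>e>0. \<exists>k0. \<forall>k\<ge>k0. \<forall>Q\<in>D. tail_expectation Q X k \<le> ennreal e)"
  unfolding Ls1_of_def uniform_limit_zero_iff by simp

lemma uniformly_integrable_iff:
  "uniformly_integrable P D \<longleftrightarrow>
     (\<forall>e>0. \<exists>k0. \<forall>k\<ge>k0. \<forall>Z\<in>D. tail_expectation P Z k \<le> ennreal e)"
  unfolding uniformly_integrable_def uniform_limit_zero_iff by simp

text \<open>Pointwise \<open>\<bar>u X + v Y\<bar> \<le> c max \<bar>X\<bar> \<bar>Y\<bar>\<close>, so where the left-hand side exceeds \<open>k\<close> the larger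
of \<open>\<bar>X\<bar>\<close> and \<open>\<bar>Y\<bar>\<close> exceeds \<open>k / c\<close>.\<close>

lemma tail_expectation_lincomb:
  assumes [measurable]: "X \<in> borel_measurable Q" "Y \<in> borel_measurable Q"
    and c: "\<bar>u\<bar> + \<bar>v\<bar> \<le> c" "0 < c"
  shows "tail_expectation Q (\<lambda>\<omega>. u * X \<omega> + v * Y \<omega>) k
           \<le> ennreal c * (tail_expectation Q X (k / c) + tail_expectation Q Y (k / c))"
proof -
  let ?i = "\<lambda>X k. indicator {\<omega>. \<bar>X \<omega>\<bar> > k}"
  have bound: "\<bar>u * x + v * y\<bar> \<le> c * max \<bar>x\<bar> \<bar>y\<bar>" for x y :: real
  proof -
    have "\<bar>u * x + v * y\<bar> \<le> \<bar>u\<bar> * \<bar>x\<bar> + \<bar>v\<bar> * \<bar>y\<bar>" by (metis abs_mult abs_triangle_ineq)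
    also have "\<dots> \<le> \<bar>u\<bar> * max \<bar>x\<bar> \<bar>y\<bar> + \<bar>v\<bar> * max \<bar>x\<bar> \<bar>y\<bar>"
      by (intro add_mono mult_left_mono) auto
    also have "\<dots> \<le> c * max \<bar>x\<bar> \<bar>y\<bar>"
      using mult_right_mono[OF c(1), of "max \<bar>x\<bar> \<bar>y\<bar>"] by (simp add: algebra_simps)
    finally show ?thesis .
  qed
  have pt: "ennreal \<bar>u * x + v * y\<bar> * indicator {x. k < x} \<bar>u * x + v * y\<bar>
    \<le> ennreal c * (ennreal \<bar>x\<bar> * indicator {x. k / c < x} \<bar>x\<bar> + ennreal \<bar>y\<bar> * indicator {x. k / c < x} \<bar>y\<bar>)"
    (is "_ \<le> ?r") for x y :: real
  proof (cases "k < \<bar>u * x + v * y\<bar>")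
    case True
    then have "k / c < max \<bar>x\<bar> \<bar>y\<bar>" using bound[of x y] c(2) by (simp add: pos_divide_less_eq mult.commute)
    then have "ennreal (max \<bar>x\<bar> \<bar>y\<bar>)
      \<le> ennreal \<bar>x\<bar> * indicator {x. k / c < x} \<bar>x\<bar> + ennreal \<bar>y\<bar> * indicator {x. k / c < x} \<bar>y\<bar>"
      by (cases "\<bar>x\<bar> \<le> \<bar>y\<bar>") (auto simp: max_def add_increasing add_increasing2)
    then have "ennreal c * ennreal (max \<bar>x\<bar> \<bar>y\<bar>) \<le> ?r" by (intro mult_left_mono) auto
    moreover have "ennreal \<bar>u * x + v * y\<bar> \<le> ennreal c * ennreal (max \<bar>x\<bar> \<bar>y\<bar>)"
      using bound[of x y] c(2) by (simp add: ennreal_mult[symmetric] ennreal_leI)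
    ultimately show ?thesis using True by auto
  qed auto
  have "tail_expectation Q (\<lambda>\<omega>. u * X \<omega> + v * Y \<omega>) k \<le>
     (\<integral>\<^sup>+\<omega>. ennreal c * (ennreal \<bar>X \<omega>\<bar> * ?i X (k / c) \<omega> + ennreal \<bar>Y \<omega>\<bar> * ?i Y (k / c) \<omega>) \<partial>Q)"
    unfolding tail_expectation_def using pt by (intro nn_integral_mono) (simp add: indicator_def)
  also have "\<dots> = ennreal c * (tail_expectation Q X (k / c) + tail_expectation Q Y (k / c))"
    unfolding tail_expectation_def indicator_def
    by (subst nn_integral_cmult, measurable, subst nn_integral_add) auto
  finally show ?thesis .
qed

lemma Ls1_of_lincomb:
  assumes D: "D \<subseteq> ac_prob_measures P" and X: "X \<in> Ls1_of P D" and Y: "Y \<in> Ls1_of P D"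
  shows "(\<lambda>\<omega>. u * X \<omega> + v * Y \<omega>) \<in> Ls1_of P D"
  unfolding Ls1_of_iff
proof (intro conjI allI impI)
  have [measurable]: "X \<in> borel_measurable P" "Y \<in> borel_measurable P"
    using X Y by (auto simp: Ls1_of_iff)
  show "(\<lambda>\<omega>. u * X \<omega> + v * Y \<omega>) \<in> borel_measurable P" by measurable
  fix e :: real assume e: "0 < e"
  define c where "c = \<bar>u\<bar> + \<bar>v\<bar> + 1"
  have c: "\<bar>u\<bar> + \<bar>v\<bar> \<le> c" "0 < c" unfolding c_def by auto
  have "0 < e / (2 * c)" using e c by auto
  then obtain kX kY where
    k: "\<And>k Q. k \<ge> kX \<Longrightarrow> Q \<in> D \<Longrightarrow> tail_expectation Q X k \<le> ennreal (e / (2 * c))"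
       "\<And>k Q. k \<ge> kY \<Longrightarrow> Q \<in> D \<Longrightarrow> tail_expectation Q Y k \<le> ennreal (e / (2 * c))"
    using X Y unfolding Ls1_of_iff by meson
  have "tail_expectation Q (\<lambda>\<omega>. u * X \<omega> + v * Y \<omega>) k \<le> ennreal e"
    if "k \<ge> max (c * kX) (c * kY)" "Q \<in> D" for k Q
  proof -
    have sQ: "sets Q = sets P" using that D unfolding ac_prob_measures_def by auto
    have [measurable]: "X \<in> borel_measurable Q" "Y \<in> borel_measurable Q"
      using measurable_cong_sets[OF sQ refl] \<open>X \<in> borel_measurable P\<close> \<open>Y \<in> borel_measurable P\<close> by blast+
    have "kX \<le> k / c" "kY \<le> k / c" using that c by (auto simp: field_simps)
    then have "ennreal c * (tail_expectation Q X (k / c) + tail_expectation Q Y (k / c))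
          \<le> ennreal c * (ennreal (e / (2 * c)) + ennreal (e / (2 * c)))"
      using k that by (intro mult_left_mono add_mono) auto
    also have "\<dots> = ennreal e" using e c
      by (subst ennreal_plus[symmetric], simp, simp, subst ennreal_mult[symmetric]) (auto simp: field_simps)
    finally show ?thesis using tail_expectation_lincomb[of X Q Y u v c k] c by (auto intro: order_trans)
  qed
  then show "\<exists>k0. \<forall>k\<ge>k0. \<forall>Q\<in>D. tail_expectation Q (\<lambda>\<omega>. u * X \<omega> + v * Y \<omega>) k \<le> ennreal e" by blast
qed

lemma Ls1_of_bounded:
  assumes "X \<in> borel_measurable P" "\<And>\<omega>. \<bar>X \<omega>\<bar> \<le> c"
  shows "X \<in> Ls1_of P D"
  unfolding Ls1_of_iff
proof (intro conjI allI impI exI[of _ c] ballI)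
  fix e k :: real and Q assume "c \<le> k"
  then have "{\<omega>. \<bar>X \<omega>\<bar> > k} = {}" using assms(2) by (force simp: not_less intro: order_trans)
  then show "tail_expectation Q X k \<le> ennreal e" unfolding tail_expectation_def by simp
qed (use assms in auto)

lemma Ls1_of_integrable:
  assumes X: "X \<in> Ls1_of P D" and Q: "Q \<in> D" "D \<subseteq> ac_prob_measures P"
  shows "integrable Q X"
proof -
  interpret Q: prob_space Q using Q unfolding ac_prob_measures_def by auto
  have sQ: "sets Q = sets P" using Q unfolding ac_prob_measures_def by auto
  have [measurable]: "X \<in> borel_measurable Q"
    using X measurable_cong_sets[OF sQ refl] by (auto simp: Ls1_of_iff)
  obtain k0 where "\<forall>k\<ge>k0. \<forall>Q\<in>D. tail_expectation Q X k \<le> ennreal 1"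
    using X unfolding Ls1_of_iff by (meson zero_less_one)
  then obtain k where k: "k \<ge> 0" "tail_expectation Q X k \<le> ennreal 1" using Q by (meson max.cobounded1 max.cobounded2)
  have "(\<integral>\<^sup>+\<omega>. ennreal \<bar>X \<omega>\<bar> \<partial>Q) \<le>
     (\<integral>\<^sup>+\<omega>. ennreal k + ennreal \<bar>X \<omega>\<bar> * indicator {\<omega>. \<bar>X \<omega>\<bar> > k} \<omega> \<partial>Q)"
    by (intro nn_integral_mono) (auto simp: indicator_def add_increasing not_less ennreal_leI)
  also have "\<dots> = ennreal k + tail_expectation Q X k"
    unfolding tail_expectation_def indicator_def
    by (subst nn_integral_add) (auto simp: Q.emeasure_space_1)
  also have "\<dots> \<le> ennreal k + ennreal 1" using k by (intro add_left_mono)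
  also have "\<dots> < \<infinity>" by simp
  finally show ?thesis by (intro integrableI_bounded) auto
qed

lemma expect_eq_integral:
  assumes "integrable Q X"
  shows "expect Q X = ereal (\<integral>\<omega>. X \<omega> \<partial>Q)"
proof -
  have fin: "(\<integral>\<^sup>+\<omega>. ennreal (max 0 (X \<omega>)) \<partial>Q) = ennreal (\<integral>\<omega>. max 0 (X \<omega>) \<partial>Q)"
    "(\<integral>\<^sup>+\<omega>. ennreal (max 0 (- X \<omega>)) \<partial>Q) = ennreal (\<integral>\<omega>. max 0 (- X \<omega>) \<partial>Q)"
    using assms by (subst nn_integral_eq_integral[symmetric]; simp)+
  have "(\<integral>\<omega>. X \<omega> \<partial>Q) = (\<integral>\<omega>. max 0 (X \<omega>) - max 0 (- X \<omega>) \<partial>Q)"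
    by (intro Bochner_Integration.integral_cong) auto
  also have "\<dots> = (\<integral>\<omega>. max 0 (X \<omega>) \<partial>Q) - (\<integral>\<omega>. max 0 (- X \<omega>) \<partial>Q)"
    using assms by (intro Bochner_Integration.integral_diff integrable_max) auto
  finally show ?thesis unfolding expect_def fin Let_def
    by (simp add: enn2ereal_ennreal integral_nonneg)
qed

section \<open>A uniformly convex functional on densities\<close>

text \<open>The function \<open>1 / (1 + z)\<close> is strictly convex for \<open>z \<ge> 0\<close> and takes values in \<open>[0, 1]\<close> there, so the
integral exists for every measurable \<open>Z\<close>.  The absolute value keeps these bounds at the points of the null set where a
version of a density may be negative.\<close>

definition reciprocal_gauge :: "'a measure \<Rightarrow> ('a \<Rightarrow> real) \<Rightarrow> real" where
  "reciprocal_gauge P Z = (\<integral>\<omega>. 1 / (1 + \<bar>Z \<omega>\<bar>) \<partial>P)"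

text \<open>With \<open>a = 1 + z\<close> and \<open>b = 1 + w\<close> the convexity gap of the reciprocal equals
\<open>(a - b)\<^sup>2 / (2 a b (a + b))\<close>.  When both \<open>z\<close> and \<open>w\<close> are at most \<open>k\<close>, the denominator is at most
\<open>4 (1 + k)\<^sup>3\<close>, and \<open>\<bar>a - b\<bar> \<le> e + (a - b)\<^sup>2 / e\<close> turns the square into a distance.  Otherwise the
truncated terms alone dominate \<open>\<bar>z - w\<bar>\<close>.\<close>

lemma reciprocal_gap_bound:
  fixes z w e k :: real
  assumes zw: "0 \<le> z" "0 \<le> w" and e: "0 < e" "0 \<le> k"
  shows "\<bar>z - w\<bar> \<le> e + 4 * (1 + k)^3 / e * ((1 / (1 + z) + 1 / (1 + w)) / 2 - 1 / (1 + (z + w) / 2))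
                    + z * indicator {k<..} z + w * indicator {k<..} w"
proof -
  define a b where "a = 1 + z" and "b = 1 + w"
  let ?G = "(1 / (1 + z) + 1 / (1 + w)) / 2 - 1 / (1 + (z + w) / 2)"
  have ab: "1 \<le> a" "1 \<le> b" "z = a - 1" "w = b - 1" unfolding a_def b_def using zw by auto
  have abp: "0 < 2 * a * b * (a + b)" using ab by (intro mult_pos_pos) auto
  have "?G = (1 / a + 1 / b) / 2 - 2 / (a + b)" unfolding a_def b_def by (auto simp: field_simps)
  also have "\<dots> = (a - b)^2 / (2 * a * b * (a + b))"
    using ab abp by (simp add: divide_simps) (simp add: algebra_simps power2_eq_square)
  finally have G: "?G = (a - b)^2 / (2 * a * b * (a + b))" .
  have G0: "0 \<le> ?G" unfolding G using abp by simp
  then have H0: "0 \<le> 4 * (1 + k)^3 / e * ?G" using e by (intro mult_nonneg_nonneg) auto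
  show ?thesis
  proof (cases "z \<le> k \<and> w \<le> k")
    case True
    have "2 * a * b * (a + b) \<le> 2 * (1 + k) * (1 + k) * ((1 + k) + (1 + k))"
      using True ab by (intro mult_mono add_mono) auto
    then have "2 * a * b * (a + b) \<le> 4 * (1 + k)^3" by (simp add: power3_eq_cube algebra_simps)
    then have "(a - b)^2 / (4 * (1 + k)^3) \<le> ?G" unfolding G using abp e by (intro divide_left_mono) auto
    then have "(a - b)^2 \<le> 4 * (1 + k)^3 * ?G" using e by (simp add: pos_divide_le_eq mult.commute)
    then have "(a - b)^2 / e \<le> 4 * (1 + k)^3 / e * ?G" using e divide_right_mono by fastforce
    moreover have "\<bar>a - b\<bar> \<le> e + (a - b)^2 / e"
    proof (cases "\<bar>a - b\<bar> \<le> e")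
      case True
      then show ?thesis using e by (smt (verit) divide_nonneg_pos zero_le_power2)
    next
      case False
      then have "\<bar>a - b\<bar> * e \<le> \<bar>a - b\<bar> * \<bar>a - b\<bar>" by (intro mult_left_mono) auto
      then have "\<bar>a - b\<bar> \<le> (a - b)^2 / e" using e by (simp add: pos_le_divide_eq power2_eq_square)
      then show ?thesis using e by auto
    qed
    ultimately show ?thesis using True ab by auto
  next
    case False
    then have "\<bar>z - w\<bar> \<le> z * indicator {k<..} z + w * indicator {k<..} w"
      using zw by (auto simp: indicator_def)
    then show ?thesis using H0 e by linarith
  qed
qed

lemma (in prob_space) reciprocal_gauge_bounds: "Z \<in> borel_measurable M \<Longrightarrow> 0 \<le> reciprocal_gauge M Z \<and> reciprocal_gauge M Z \<le> 1"
  unfolding reciprocal_gauge_def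
  by (intro conjI integral_nonneg integral_le_const integrable_const_bound[of _ 1]) auto

text \<open>The integrated form of \<open>reciprocal_gap_bound\<close>.\<close>

lemma (in prob_space) L1_distance_le_gauge_gap:
  assumes Z: "integrable M Z" "AE \<omega> in M. 0 \<le> Z \<omega>" and W: "integrable M W" "AE \<omega> in M. 0 \<le> W \<omega>"
    and e: "0 < e" "0 \<le> k"
    and tails: "tail_expectation M Z k \<le> ennreal e" "tail_expectation M W k \<le> ennreal e"
  shows "(\<integral>\<omega>. \<bar>Z \<omega> - W \<omega>\<bar> \<partial>M) \<le>
    3 * e + 4 * (1 + k)^3 / e * ((reciprocal_gauge M Z + reciprocal_gauge M W) / 2 - reciprocal_gauge M (\<lambda>\<omega>. (Z \<omega> + W \<omega>) / 2))"
proof -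
  have [measurable]: "Z \<in> borel_measurable M" "W \<in> borel_measurable M" using Z W by auto
  define c where "c = 4 * (1 + k)^3 / e"
  have gi: "integrable M (\<lambda>\<omega>. 1 / (1 + \<bar>Y \<omega>\<bar>))" if [measurable]: "Y \<in> borel_measurable M" for Y :: "'a \<Rightarrow> real"
    by (intro integrable_const_bound[of _ 1]) auto
  have ti: "integrable M (\<lambda>\<omega>. \<bar>Y \<omega>\<bar> * indicator {k<..} \<bar>Y \<omega>\<bar>)"
    if "integrable M Y" for Y :: "'a \<Rightarrow> real"
    using that by (intro Bochner_Integration.integrable_bound[OF that]) (auto simp: indicator_def)
  have te: "(\<integral>\<omega>. \<bar>Y \<omega>\<bar> * indicator {k<..} \<bar>Y \<omega>\<bar> \<partial>M) \<le> e"
    if Y: "integrable M Y" "tail_expectation M Y k \<le> ennreal e" for Y :: "'a \<Rightarrow> real"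
  proof -
    have "ennreal (\<integral>\<omega>. \<bar>Y \<omega>\<bar> * indicator {k<..} \<bar>Y \<omega>\<bar> \<partial>M) = tail_expectation M Y k"
      unfolding tail_expectation_def
      by (subst nn_integral_eq_integral[symmetric, OF ti[OF Y(1)]])
        (simp, intro nn_integral_cong, simp add: indicator_def)
    then have "ennreal (\<integral>\<omega>. \<bar>Y \<omega>\<bar> * indicator {k<..} \<bar>Y \<omega>\<bar> \<partial>M) \<le> ennreal e"
      using Y(2) by simp
    then show ?thesis using e by (simp add: ennreal_le_iff)
  qed
  have gapi: "integrable M (\<lambda>\<omega>. (1 / (1 + \<bar>Z \<omega>\<bar>) + 1 / (1 + \<bar>W \<omega>\<bar>)) / 2 - 1 / (1 + \<bar>(Z \<omega> + W \<omega>) / 2\<bar>))"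
    by (intro Bochner_Integration.integrable_diff integrable_divide Bochner_Integration.integrable_add gi) measurable
  have "(\<integral>\<omega>. \<bar>Z \<omega> - W \<omega>\<bar> \<partial>M) \<le>
    (\<integral>\<omega>. e + c * ((1 / (1 + \<bar>Z \<omega>\<bar>) + 1 / (1 + \<bar>W \<omega>\<bar>)) / 2 - 1 / (1 + \<bar>(Z \<omega> + W \<omega>) / 2\<bar>))
       + \<bar>Z \<omega>\<bar> * indicator {k<..} \<bar>Z \<omega>\<bar> + \<bar>W \<omega>\<bar> * indicator {k<..} \<bar>W \<omega>\<bar> \<partial>M)"
  proof (rule integral_mono_AE)
    show "AE \<omega> in M. \<bar>Z \<omega> - W \<omega>\<bar> \<le>
      e + c * ((1 / (1 + \<bar>Z \<omega>\<bar>) + 1 / (1 + \<bar>W \<omega>\<bar>)) / 2 - 1 / (1 + \<bar>(Z \<omega> + W \<omega>) / 2\<bar>))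
       + \<bar>Z \<omega>\<bar> * indicator {k<..} \<bar>Z \<omega>\<bar> + \<bar>W \<omega>\<bar> * indicator {k<..} \<bar>W \<omega>\<bar>"
      using Z(2) W(2)
    proof eventually_elim
      case (elim \<omega>)
      then have "\<bar>Z \<omega>\<bar> = Z \<omega>" "\<bar>W \<omega>\<bar> = W \<omega>" "\<bar>(Z \<omega> + W \<omega>) / 2\<bar> = (Z \<omega> + W \<omega>) / 2" by auto
      then show ?case using reciprocal_gap_bound[OF elim e] unfolding c_def by (simp only:)
    qed
  qed (use Z W gapi ti in auto)
  also have "\<dots> = e + c * (\<integral>\<omega>. (1 / (1 + \<bar>Z \<omega>\<bar>) + 1 / (1 + \<bar>W \<omega>\<bar>)) / 2 - 1 / (1 + \<bar>(Z \<omega> + W \<omega>) / 2\<bar>) \<partial>M)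
       + (\<integral>\<omega>. \<bar>Z \<omega>\<bar> * indicator {k<..} \<bar>Z \<omega>\<bar> \<partial>M) + (\<integral>\<omega>. \<bar>W \<omega>\<bar> * indicator {k<..} \<bar>W \<omega>\<bar> \<partial>M)"
    using gapi ti[OF Z(1)] ti[OF W(1)] by (simp add: prob_space del: integral_divide_zero)
  also have "(\<integral>\<omega>. (1 / (1 + \<bar>Z \<omega>\<bar>) + 1 / (1 + \<bar>W \<omega>\<bar>)) / 2 - 1 / (1 + \<bar>(Z \<omega> + W \<omega>) / 2\<bar>) \<partial>M)
     = (reciprocal_gauge M Z + reciprocal_gauge M W) / 2 - reciprocal_gauge M (\<lambda>\<omega>. (Z \<omega> + W \<omega>) / 2)"
    unfolding reciprocal_gauge_def using gi[of Z] gi[of W] gi[of "\<lambda>\<omega>. (Z \<omega> + W \<omega>) / 2"]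
    by (subst Bochner_Integration.integral_diff) auto
  finally show ?thesis using te[OF Z(1) tails(1)] te[OF W(1) tails(2)] unfolding c_def by linarith
qed

text \<open>A subsequence converges almost everywhere to some \<open>z\<close>, and Fatou's lemma applied to \<open>\<bar>s k - s (r i)\<bar>\<close> in
\<open>i\<close> transfers the Cauchy estimate to \<open>\<bar>s k - z\<bar>\<close>.\<close>

lemma L1_complete:
  fixes s :: "nat \<Rightarrow> 'a \<Rightarrow> real"
  assumes s: "\<And>n. integrable M (s n)"
    and cauchy: "\<And>e. 0 < e \<Longrightarrow> \<exists>k. \<forall>i\<ge>k. \<forall>j\<ge>k. (\<integral>\<omega>. \<bar>s i \<omega> - s j \<omega>\<bar> \<partial>M) < e"
  shows "\<exists>z. integrable M z \<and> (\<lambda>k. \<integral>\<omega>. \<bar>s k \<omega> - z \<omega>\<bar> \<partial>M) \<longlonglongrightarrow> 0"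
proof -
  have [measurable]: "s n \<in> borel_measurable M" for n using s by auto
  obtain r where r: "strict_mono r" "AE \<omega> in M. Cauchy (\<lambda>i. s (r i) \<omega>)"
    using cauchy_L1_AE_cauchy_subseq[of M s] s cauchy by (auto simp: real_norm_def)
  define z where "z \<omega> = lim (\<lambda>i. s (r i) \<omega>)" for \<omega>
  have [measurable]: "z \<in> borel_measurable M" unfolding z_def by measurable
  have lim: "AE \<omega> in M. (\<lambda>i. s (r i) \<omega>) \<longlonglongrightarrow> z \<omega>"
    using r(2) unfolding z_def Cauchy_convergent_iff convergent_LIMSEQ_iff by simp
  have bound: "(\<integral>\<^sup>+\<omega>. ennreal \<bar>s k \<omega> - z \<omega>\<bar> \<partial>M) \<le> ennreal e"
    if k: "\<forall>i\<ge>k0. \<forall>j\<ge>k0. (\<integral>\<omega>. \<bar>s i \<omega> - s j \<omega>\<bar> \<partial>M) < e" "k \<ge> k0" for e k k0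
  proof -
    have "(\<integral>\<^sup>+\<omega>. ennreal \<bar>s k \<omega> - z \<omega>\<bar> \<partial>M) = (\<integral>\<^sup>+\<omega>. liminf (\<lambda>i. ennreal \<bar>s k \<omega> - s (r i) \<omega>\<bar>) \<partial>M)"
    proof (rule nn_integral_cong_AE)
      show "AE \<omega> in M. ennreal \<bar>s k \<omega> - z \<omega>\<bar> = liminf (\<lambda>i. ennreal \<bar>s k \<omega> - s (r i) \<omega>\<bar>)"
        using lim
      proof eventually_elim
        case (elim \<omega>)
        then have "(\<lambda>i. ennreal \<bar>s k \<omega> - s (r i) \<omega>\<bar>) \<longlonglongrightarrow> ennreal \<bar>s k \<omega> - z \<omega>\<bar>"
          by (intro tendsto_ennrealI tendsto_intros)
        then show ?case by (metis lim_imp_Liminf trivial_limit_sequentially)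
      qed
    qed
    also have "\<dots> \<le> liminf (\<lambda>i. \<integral>\<^sup>+\<omega>. ennreal \<bar>s k \<omega> - s (r i) \<omega>\<bar> \<partial>M)"
      by (intro nn_integral_liminf) auto
    also have "\<dots> \<le> liminf (\<lambda>i. ennreal e)"
    proof (rule Liminf_mono)
      show "\<forall>\<^sub>F i in sequentially. (\<integral>\<^sup>+\<omega>. ennreal \<bar>s k \<omega> - s (r i) \<omega>\<bar> \<partial>M) \<le> ennreal e"
      proof (rule eventually_sequentiallyI[of k0])
        fix i assume "k0 \<le> i"
        then have "k0 \<le> r i" using seq_suble[OF r(1), of i] by auto
        then have "(\<integral>\<omega>. \<bar>s k \<omega> - s (r i) \<omega>\<bar> \<partial>M) \<le> e" using k by (auto intro: less_imp_le)
        then show "(\<integral>\<^sup>+\<omega>. ennreal \<bar>s k \<omega> - s (r i) \<omega>\<bar> \<partial>M) \<le> ennreal e"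
          using s by (subst nn_integral_eq_integral) (auto intro: ennreal_leI)
      qed
    qed
    also have "\<dots> = ennreal e" by (simp add: Liminf_const)
    finally show ?thesis .
  qed
  have zi: "integrable M z"
  proof -
    obtain k where k: "\<forall>i\<ge>k. \<forall>j\<ge>k. (\<integral>\<omega>. \<bar>s i \<omega> - s j \<omega>\<bar> \<partial>M) < 1" using cauchy[of 1] by auto
    have "integrable M (\<lambda>\<omega>. s k \<omega> - z \<omega>)"
      using bound[OF k order_refl] by (intro integrableI_bounded) (auto intro: le_less_trans)
    from Bochner_Integration.integrable_diff[OF s[of k] this] show ?thesis by (simp only: diff_diff_eq2 add_diff_cancel_left')
  qed
  have "(\<lambda>k. \<integral>\<omega>. \<bar>s k \<omega> - z \<omega>\<bar> \<partial>M) \<longlonglongrightarrow> 0"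
  proof (rule LIMSEQ_I)
    fix e :: real assume "0 < e"
    then obtain k0 where k0: "\<forall>i\<ge>k0. \<forall>j\<ge>k0. (\<integral>\<omega>. \<bar>s i \<omega> - s j \<omega>\<bar> \<partial>M) < e / 2" using cauchy[of "e/2"] by auto
    have "norm ((\<integral>\<omega>. \<bar>s k \<omega> - z \<omega>\<bar> \<partial>M) - 0) < e" if "k \<ge> k0" for k
    proof -
      have "ennreal (\<integral>\<omega>. \<bar>s k \<omega> - z \<omega>\<bar> \<partial>M) \<le> ennreal (e / 2)"
        using bound[OF k0 that] s zi by (subst (asm) nn_integral_eq_integral) auto
      then show ?thesis using \<open>0 < e\<close> by (simp add: ennreal_le_iff)
    qed
    then show "\<exists>k0. \<forall>k\<ge>k0. norm ((\<integral>\<omega>. \<bar>s k \<omega> - z \<omega>\<bar> \<partial>M) - 0) < e" by blast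
  qed
  then show ?thesis using zi by blast
qed

section \<open>Expectations in terms of densities\<close>

lemma densitiesD:
  assumes "z \<in> densities P D"
  shows "integrable P z" "AE \<omega> in P. 0 \<le> z \<omega>" "density P (\<lambda>\<omega>. ennreal (z \<omega>)) \<in> D" "z \<in> borel_measurable P"
  using assms unfolding densities_def by auto

lemma integral_wrt_density:
  fixes X :: "'a \<Rightarrow> real"
  assumes z: "z \<in> densities P D" and D: "D \<subseteq> ac_prob_measures P" and X: "X \<in> Ls1_of P D"
  shows "integrable P (\<lambda>\<omega>. z \<omega> * X \<omega>)"
    and "(\<integral>\<omega>. X \<omega> \<partial>density P (\<lambda>\<omega>. ennreal (z \<omega>))) = (\<integral>\<omega>. z \<omega> * X \<omega> \<partial>P)"
proof -
  note z' = densitiesD[OF z]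
  have XP: "X \<in> borel_measurable P" using X by (simp add: Ls1_of_iff)
  show "integrable P (\<lambda>\<omega>. z \<omega> * X \<omega>)"
    using Ls1_of_integrable[OF X z'(3) D] integrable_density[OF XP z'(4,2)] by simp
  show "(\<integral>\<omega>. X \<omega> \<partial>density P (\<lambda>\<omega>. ennreal (z \<omega>))) = (\<integral>\<omega>. z \<omega> * X \<omega> \<partial>P)"
    using integral_density[OF XP z'(4,2)] by simp
qed

lemma tail_wrt_density:
  assumes z: "z \<in> densities P D" and D: "D \<subseteq> ac_prob_measures P" and X: "X \<in> Ls1_of P D"
    and t: "tail_expectation (density P (\<lambda>\<omega>. ennreal (z \<omega>))) X c \<le> ennreal e" "0 \<le> e"
  shows "integrable P (\<lambda>\<omega>. z \<omega> * (\<bar>X \<omega>\<bar> * indicator {c<..} \<bar>X \<omega>\<bar>))"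
    and "(\<integral>\<omega>. z \<omega> * (\<bar>X \<omega>\<bar> * indicator {c<..} \<bar>X \<omega>\<bar>) \<partial>P) \<le> e"
proof -
  note z' = densitiesD[OF z]
  have [measurable]: "X \<in> borel_measurable P" using X by (simp add: Ls1_of_iff)
  have [measurable]: "z \<in> borel_measurable P" by fact
  show int: "integrable P (\<lambda>\<omega>. z \<omega> * (\<bar>X \<omega>\<bar> * indicator {c<..} \<bar>X \<omega>\<bar>))"
    using integral_wrt_density(1)[OF z D X]
    by (rule Bochner_Integration.integrable_bound) (simp_all add: indicator_def abs_mult)
  have "ennreal (\<integral>\<omega>. z \<omega> * (\<bar>X \<omega>\<bar> * indicator {c<..} \<bar>X \<omega>\<bar>) \<partial>P)
        = (\<integral>\<^sup>+\<omega>. ennreal (z \<omega> * (\<bar>X \<omega>\<bar> * indicator {c<..} \<bar>X \<omega>\<bar>)) \<partial>P)"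
    using int z'(2) by (subst nn_integral_eq_integral) auto
  also have "\<dots> = tail_expectation (density P (\<lambda>\<omega>. ennreal (z \<omega>))) X c"
    unfolding tail_expectation_def
    by (subst nn_integral_density, simp, simp add: indicator_def, rule nn_integral_cong_AE)
      (use z'(2) in \<open>eventually_elim, simp add: indicator_def ennreal_mult\<close>)
  finally have "ennreal (\<integral>\<omega>. z \<omega> * (\<bar>X \<omega>\<bar> * indicator {c<..} \<bar>X \<omega>\<bar>) \<partial>P) \<le> ennreal e" using t(1) by simp
  then show "(\<integral>\<omega>. z \<omega> * (\<bar>X \<omega>\<bar> * indicator {c<..} \<bar>X \<omega>\<bar>) \<partial>P) \<le> e" using t(2) by (simp add: ennreal_le_iff)
qed

text \<open>The positions \<open>X\<close> may be unbounded, so \<open>L\<^sup>1\<close> convergence of the densities alone does not suffice.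
Below a level \<open>c\<close> the difference is at most \<open>c\<close> times the \<open>L\<^sup>1\<close> distance; above it, the tails of
\<open>X\<close> are small uniformly over \<open>D\<close>, which contains the measures of all densities involved.\<close>

lemma integral_wrt_density_tendsto:
  assumes zs: "\<And>k::nat. zs k \<in> densities P D" and z: "z \<in> densities P D"
    and D: "D \<subseteq> ac_prob_measures P" and X: "X \<in> Ls1_of P D"
    and conv: "(\<lambda>k. \<integral>\<omega>. \<bar>zs k \<omega> - z \<omega>\<bar> \<partial>P) \<longlonglongrightarrow> 0"
  shows "(\<lambda>k. \<integral>\<omega>. zs k \<omega> * X \<omega> \<partial>P) \<longlonglongrightarrow> (\<integral>\<omega>. z \<omega> * X \<omega> \<partial>P)"
proof (rule LIMSEQ_I)
  fix e :: real assume e: "0 < e"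
  have [measurable]: "X \<in> borel_measurable P" using X by (simp add: Ls1_of_iff)
  obtain c0 where "\<forall>c\<ge>c0. \<forall>Q\<in>D. tail_expectation Q X c \<le> ennreal (e / 4)"
    using X e unfolding Ls1_of_iff by (meson divide_pos_pos zero_less_numeral)
  then obtain c where c: "0 < c" "\<And>Q. Q \<in> D \<Longrightarrow> tail_expectation Q X c \<le> ennreal (e / 4)"
    by (meson max.cobounded1 max.cobounded2 less_le_trans zero_less_one)
  let ?T = "\<lambda>w \<omega>. w \<omega> * (\<bar>X \<omega>\<bar> * indicator {c<..} \<bar>X \<omega>\<bar>)"
  have T: "integrable P (?T w)" "(\<integral>\<omega>. ?T w \<omega> \<partial>P) \<le> e / 4" if w: "w \<in> densities P D" for w
    using tail_wrt_density[OF w D X c(2)[OF densitiesD(3)[OF w]]] e by auto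
  have est: "\<bar>(\<integral>\<omega>. zs k \<omega> * X \<omega> \<partial>P) - (\<integral>\<omega>. z \<omega> * X \<omega> \<partial>P)\<bar> \<le> c * (\<integral>\<omega>. \<bar>zs k \<omega> - z \<omega>\<bar> \<partial>P) + e / 2" for k
  proof -
    note I = integral_wrt_density(1)[OF zs[of k] D X] integral_wrt_density(1)[OF z D X]
    note A = densitiesD[OF zs[of k]] densitiesD[OF z]
    have dI: "integrable P (\<lambda>\<omega>. \<bar>zs k \<omega> - z \<omega>\<bar>)" using A by auto
    have "\<bar>(\<integral>\<omega>. zs k \<omega> * X \<omega> \<partial>P) - (\<integral>\<omega>. z \<omega> * X \<omega> \<partial>P)\<bar> = \<bar>\<integral>\<omega>. zs k \<omega> * X \<omega> - z \<omega> * X \<omega> \<partial>P\<bar>"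
      using I by simp
    also have "\<dots> \<le> (\<integral>\<omega>. \<bar>zs k \<omega> * X \<omega> - z \<omega> * X \<omega>\<bar> \<partial>P)" by (rule integral_abs_bound)
    also have "\<dots> \<le> (\<integral>\<omega>. c * \<bar>zs k \<omega> - z \<omega>\<bar> + (?T (zs k) \<omega> + ?T z \<omega>) \<partial>P)"
    proof (rule integral_mono_AE)
      show "AE \<omega> in P. \<bar>zs k \<omega> * X \<omega> - z \<omega> * X \<omega>\<bar> \<le> c * \<bar>zs k \<omega> - z \<omega>\<bar> + (?T (zs k) \<omega> + ?T z \<omega>)"
        using A(2) A(6)
      proof eventually_elim
        case (elim \<omega>)
        have eq: "\<bar>zs k \<omega> * X \<omega> - z \<omega> * X \<omega>\<bar> = \<bar>zs k \<omega> - z \<omega>\<bar> * \<bar>X \<omega>\<bar>"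
          by (simp add: abs_mult[symmetric] left_diff_distrib)
        show ?case
        proof (cases "c < \<bar>X \<omega>\<bar>")
          case True
          have "\<bar>zs k \<omega> - z \<omega>\<bar> * \<bar>X \<omega>\<bar> \<le> (zs k \<omega> + z \<omega>) * \<bar>X \<omega>\<bar>"
            using elim by (intro mult_right_mono) auto
          moreover have "0 \<le> c * \<bar>zs k \<omega> - z \<omega>\<bar>" using c by simp
          ultimately show ?thesis using True unfolding eq by (simp add: distrib_right)
        next
          case False
          then have "\<bar>zs k \<omega> - z \<omega>\<bar> * \<bar>X \<omega>\<bar> \<le> \<bar>zs k \<omega> - z \<omega>\<bar> * c" by (intro mult_left_mono) auto
          then show ?thesis using False unfolding eq by (simp add: mult.commute)
        qed
      qed
    qed (use I dI T[OF zs[of k]] T[OF z] in \<open>auto intro!: Bochner_Integration.integrable_add\<close>)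
    also have "\<dots> = c * (\<integral>\<omega>. \<bar>zs k \<omega> - z \<omega>\<bar> \<partial>P) + ((\<integral>\<omega>. ?T (zs k) \<omega> \<partial>P) + (\<integral>\<omega>. ?T z \<omega> \<partial>P))"
      using dI T(1)[OF zs[of k]] T(1)[OF z]
      by (subst Bochner_Integration.integral_add, simp, simp, subst Bochner_Integration.integral_add) auto
    finally show ?thesis using T(2)[OF zs[of k]] T(2)[OF z] by linarith
  qed
  obtain k0 where k0: "\<And>k. k \<ge> k0 \<Longrightarrow> norm ((\<integral>\<omega>. \<bar>zs k \<omega> - z \<omega>\<bar> \<partial>P) - 0) < e / (2 * c)"
    using LIMSEQ_D[OF conv, of "e / (2 * c)"] e c by auto
  have "norm ((\<integral>\<omega>. zs k \<omega> * X \<omega> \<partial>P) - (\<integral>\<omega>. z \<omega> * X \<omega> \<partial>P)) < e" if "k \<ge> k0" for k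
  proof -
    have "(\<integral>\<omega>. \<bar>zs k \<omega> - z \<omega>\<bar> \<partial>P) < e / (2 * c)" using k0[OF that] by simp
    then have "c * (\<integral>\<omega>. \<bar>zs k \<omega> - z \<omega>\<bar> \<partial>P) < e / 2" using c by (simp add: field_simps)
    then show ?thesis using est[of k] by (simp del: integral_mult_right_zero)
  qed
  then show "\<exists>k0. \<forall>k\<ge>k0. norm ((\<integral>\<omega>. zs k \<omega> * X \<omega> \<partial>P) - (\<integral>\<omega>. z \<omega> * X \<omega> \<partial>P)) < e" by blast
qed

lemma (in prob_space) density_exists:
  assumes Q: "Q \<in> D" "D \<subseteq> ac_prob_measures M"
  obtains z where "z \<in> densities M D" "density M (\<lambda>\<omega>. ennreal (z \<omega>)) = Q"
proof -
  have Q': "sets Q = sets M" "prob_space Q" "absolutely_continuous M Q"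
    using Q unfolding ac_prob_measures_def by auto
  interpret Q: prob_space Q by fact
  obtain z where z: "z \<in> borel_measurable M" "AE \<omega> in M. RN_deriv M Q \<omega> = ennreal (z \<omega>)" "\<And>\<omega>. 0 \<le> z \<omega>"
    using real_RN_deriv[OF Q.finite_measure_axioms Q'(3,1)] by blast
  have "density M (\<lambda>\<omega>. ennreal (z \<omega>)) = density M (RN_deriv M Q)"
    using z(1,2) by (intro density_cong) auto
  also have "\<dots> = Q" using density_RN_deriv[OF Q'(3,1)] .
  finally have eq: "density M (\<lambda>\<omega>. ennreal (z \<omega>)) = Q" .
  have "(\<integral>\<^sup>+\<omega>. ennreal (z \<omega>) \<partial>M) = emeasure Q (space M)"
    unfolding eq[symmetric] using z(1) by (subst emeasure_density) (auto intro!: nn_integral_cong)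
  also have "\<dots> = 1" using Q.emeasure_space_1 sets_eq_imp_space_eq[OF Q'(1)] by simp
  finally have "integrable M z" using z by (intro integrableI_nonneg) auto
  then show ?thesis using that[of z] z eq Q(1) unfolding densities_def by auto
qed

section \<open>Tuples of densities\<close>

lemma acceptableI:
  assumes "X \<in> Ls1 P N V"
    and "\<And>n. n \<in> {1..N} \<Longrightarrow> Xs n \<in> group_acceptable P N V n"
    and "\<And>\<omega>. (\<Sum>n=1..N. Xs n \<omega>) = X \<omega>"
  shows "X \<in> acceptable P N V"
proof -
  have "AE \<omega> in P. (\<Sum>n=1..N. Xs n \<omega>) = X \<omega>" using assms(3) by (intro AE_I2)
  moreover have "\<forall>n\<in>{1..N}. Xs n \<in> Ls1 P N V" using assms(2) by (simp add: group_acceptable_def)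
  moreover have "\<forall>n\<in>{1..N}. Xs n \<in> group_acceptable P N V n" using assms(2) by blast
  ultimately have "\<exists>Ys. (\<forall>n\<in>{1..N}. Ys n \<in> Ls1 P N V) \<and> (AE \<omega> in P. (\<Sum>n=1..N. Ys n \<omega>) = X \<omega>) \<and>
      (\<forall>n\<in>{1..N}. Ys n \<in> group_acceptable P N V n)" by (intro exI[of _ Xs] conjI)
  with assms(1) have "X \<in> {X \<in> Ls1 P N V. \<exists>Ys. (\<forall>n\<in>{1..N}. Ys n \<in> Ls1 P N V) \<and> (AE \<omega> in P. (\<Sum>n=1..N. Ys n \<omega>) = X \<omega>) \<and>
      (\<forall>n\<in>{1..N}. Ys n \<in> group_acceptable P N V n)}" by (intro CollectI conjI)
  then show ?thesis unfolding acceptable_def .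
qed

locale valuation_groups = prob_space P for P :: "'a measure" +
  fixes N :: nat and V :: "nat \<Rightarrow> 'a measure set"
  assumes N_pos: "1 \<le> N"
    and V_ac: "\<And>n. n \<in> {1..N} \<Longrightarrow> V n \<subseteq> ac_prob_measures P"
    and V_ne: "\<And>n. n \<in> {1..N} \<Longrightarrow> V n \<noteq> {}"
    and V_convex: "\<And>n. n \<in> {1..N} \<Longrightarrow> convex_rvs (densities P (V n))"
    and V_closed: "\<And>n. n \<in> {1..N} \<Longrightarrow> L1_closed P (densities P (V n))"
    and V_ui: "\<And>n. n \<in> {1..N} \<Longrightarrow> uniformly_integrable P (densities P (V n))"
begin

abbreviation L where "L \<equiv> Ls1 P N V"

definition profiles :: "(nat \<Rightarrow> 'a \<Rightarrow> real) set" where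
  "profiles = {z. \<forall>n\<in>{1..N}. z n \<in> densities P (V n)}"

definition total_expectation :: "(nat \<Rightarrow> 'a \<Rightarrow> real) \<Rightarrow> (nat \<Rightarrow> 'a \<Rightarrow> real) \<Rightarrow> real" where
  "total_expectation X z = (\<Sum>n=1..N. \<integral>\<omega>. z n \<omega> * X n \<omega> \<partial>P)"

lemma L_D: "X \<in> L \<Longrightarrow> n \<in> {1..N} \<Longrightarrow> X \<in> Ls1_of P (V n)"
  by (simp add: Ls1_def)

lemma L_measurable: "X \<in> L \<Longrightarrow> X \<in> borel_measurable P"
  using L_D[of X 1] N_pos by (auto simp: Ls1_of_iff)

lemma L_lincomb: "X \<in> L \<Longrightarrow> Y \<in> L \<Longrightarrow> (\<lambda>\<omega>. u * X \<omega> + v * Y \<omega>) \<in> L"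
  unfolding Ls1_def by (rule INT_I, rule Ls1_of_lincomb[OF V_ac]) (assumption | erule (1) INT_D)+

lemma L_bounded: "X \<in> borel_measurable P \<Longrightarrow> (\<And>\<omega>. \<bar>X \<omega>\<bar> \<le> c) \<Longrightarrow> X \<in> L"
  unfolding Ls1_def by (rule INT_I, rule Ls1_of_bounded)

lemma L_const: "(\<lambda>_. c) \<in> L"
  by (rule L_bounded[of _ "\<bar>c\<bar>"]) auto

lemma L_integrable: "X \<in> L \<Longrightarrow> n \<in> {1..N} \<Longrightarrow> Q \<in> V n \<Longrightarrow> integrable Q X"
  by (rule Ls1_of_integrable[OF L_D _ V_ac])

lemma profilesD: "z \<in> profiles \<Longrightarrow> n \<in> {1..N} \<Longrightarrow> z n \<in> densities P (V n)"
  by (simp add: profiles_def)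

lemma density_times_integrable:
  "X \<in> L \<Longrightarrow> n \<in> {1..N} \<Longrightarrow> z \<in> densities P (V n) \<Longrightarrow> integrable P (\<lambda>\<omega>. z \<omega> * X \<omega>)"
  by (rule integral_wrt_density(1)[OF _ V_ac L_D])

lemma profiles_mix:
  assumes "z \<in> profiles" "w \<in> profiles" "0 \<le> u" "0 \<le> v" "u + v = 1"
  shows "(\<lambda>n \<omega>. u * z n \<omega> + v * w n \<omega>) \<in> profiles"
  using assms V_convex unfolding profiles_def convex_rvs_def by auto

lemma total_expectation_mix:
  assumes z: "z \<in> profiles" "w \<in> profiles" and X: "\<And>n. n \<in> {1..N} \<Longrightarrow> X n \<in> L"
  shows "total_expectation X (\<lambda>n \<omega>. u * z n \<omega> + v * w n \<omega>) = u * total_expectation X z + v * total_expectation X w"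
proof -
  have "(\<integral>\<omega>. (u * z n \<omega> + v * w n \<omega>) * X n \<omega> \<partial>P)
      = u * (\<integral>\<omega>. z n \<omega> * X n \<omega> \<partial>P) + v * (\<integral>\<omega>. w n \<omega> * X n \<omega> \<partial>P)" if n: "n \<in> {1..N}" for n
  proof -
    have "(\<integral>\<omega>. (u * z n \<omega> + v * w n \<omega>) * X n \<omega> \<partial>P)
        = (\<integral>\<omega>. u * (z n \<omega> * X n \<omega>) + v * (w n \<omega> * X n \<omega>) \<partial>P)"
      by (simp add: algebra_simps)
    then show ?thesis
      using density_times_integrable[OF X[OF n] n profilesD[OF z(1) n]] density_times_integrable[OF X[OF n] n profilesD[OF z(2) n]]
      by simp
  qed
  then show ?thesis unfolding total_expectation_def
    by (simp add: sum.distrib sum_distrib_left)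
qed

lemma total_expectation_lincomb:
  assumes z: "z \<in> profiles" and X: "\<And>n. n \<in> {1..N} \<Longrightarrow> X n \<in> L" and Y: "\<And>n. n \<in> {1..N} \<Longrightarrow> Y n \<in> L"
  shows "total_expectation (\<lambda>n \<omega>. u * X n \<omega> + v * Y n \<omega>) z = u * total_expectation X z + v * total_expectation Y z"
proof -
  have "(\<integral>\<omega>. z n \<omega> * (u * X n \<omega> + v * Y n \<omega>) \<partial>P)
      = u * (\<integral>\<omega>. z n \<omega> * X n \<omega> \<partial>P) + v * (\<integral>\<omega>. z n \<omega> * Y n \<omega> \<partial>P)" if n: "n \<in> {1..N}" for n
  proof -
    have "(\<integral>\<omega>. z n \<omega> * (u * X n \<omega> + v * Y n \<omega>) \<partial>P)
        = (\<integral>\<omega>. u * (z n \<omega> * X n \<omega>) + v * (z n \<omega> * Y n \<omega>) \<partial>P)"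
      by (simp add: algebra_simps)
    then show ?thesis
      using density_times_integrable[OF X[OF n] n profilesD[OF z n]] density_times_integrable[OF Y[OF n] n profilesD[OF z n]]
      by simp
  qed
  then show ?thesis unfolding total_expectation_def
    by (simp add: sum.distrib sum_distrib_left)
qed

text \<open>The infima \<open>m n\<close> of the individual expectations add up to some \<open>M \<ge> e\<close>, because the densities of the groups vary
independently.  Shifting the \<open>n\<close>-th position by the constant \<open>M / N - m n\<close> makes all the infima equal to
\<open>M / N > 0\<close>, and since these constants add up to \<open>0\<close>, the sum of the positions stays the same.\<close>

lemma acceptable_if_total_expectation_bounded_below:
  assumes X: "\<And>n. n \<in> {1..N} \<Longrightarrow> X n \<in> L" and sumL: "(\<lambda>\<omega>. \<Sum>n=1..N. X n \<omega>) \<in> L"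
    and e: "0 < e" and low: "\<And>z. z \<in> profiles \<Longrightarrow> e \<le> total_expectation X z"
  shows "(\<lambda>\<omega>. \<Sum>n=1..N. X n \<omega>) \<in> acceptable P N V"
proof -
  define J where "J n z = (\<integral>\<omega>. z \<omega> * X n \<omega> \<partial>P)" for n z
  define m where "m n = Inf (J n ` densities P (V n))" for n
  have dne: "densities P (V n) \<noteq> {}" if "n \<in> {1..N}" for n
    using V_ne[OF that] V_ac[OF that] density_exists[of _ "V n"] by blast
  then have "\<forall>n. \<exists>z. n \<in> {1..N} \<longrightarrow> z \<in> densities P (V n)" by blast
  then obtain z0 where z0: "\<And>n. n \<in> {1..N} \<Longrightarrow> z0 n \<in> densities P (V n)" by metis
  \<comment> \<open>Fixing the densities of the other groups turns the bound on the sum into one for the \<open>n\<close>-th term.\<close>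
  have bdd: "bdd_below (J n ` densities P (V n))" if n: "n \<in> {1..N}" for n
  proof (rule bdd_belowI2)
    fix z assume z: "z \<in> densities P (V n)"
    have "z0(n := z) \<in> profiles" using z0 z unfolding profiles_def by auto
    from low[OF this] have "e \<le> (\<Sum>i=1..N. J i ((z0(n := z)) i))"
      unfolding total_expectation_def J_def .
    also have "\<dots> = J n z + (\<Sum>i\<in>{1..N} - {n}. J i (z0 i))"
      using n by (subst sum.remove[of _ n]) (auto intro!: sum.cong)
    finally show "e - (\<Sum>i\<in>{1..N} - {n}. J i (z0 i)) \<le> J n z" by simp
  qed
  define M where "M = (\<Sum>n=1..N. m n)"
  have "e \<le> M"
  proof (rule field_le_epsilon)
    fix r :: real assume r: "0 < r"
    have "\<exists>z\<in>densities P (V n). J n z < m n + r / N" if n: "n \<in> {1..N}" for n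
    proof -
      have "0 < r / N" using r N_pos by simp
      then show ?thesis
        using cInf_lessD[of "J n ` densities P (V n)" "m n + r / N"] dne[OF n] unfolding m_def by auto
    qed
    then have "\<forall>n. \<exists>z. n \<in> {1..N} \<longrightarrow> z \<in> densities P (V n) \<and> J n z < m n + r / N" by blast
    then obtain z where z: "\<And>n. n \<in> {1..N} \<Longrightarrow> z n \<in> densities P (V n) \<and> J n (z n) < m n + r / N" by metis
    then have "e \<le> (\<Sum>n=1..N. J n (z n))" using low[of z] unfolding profiles_def total_expectation_def J_def by blast
    also have "\<dots> \<le> (\<Sum>n=1..N. m n + r / N)" using z by (intro sum_mono less_imp_le) blast
    also have "\<dots> = M + r" unfolding M_def using N_pos by (simp add: sum.distrib)
    finally show "e \<le> M + r" .
  qed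
  define Y where "Y n \<omega> = X n \<omega> - (m n - M / N)" for n \<omega>
  have YL: "Y n \<in> L" if "n \<in> {1..N}" for n
  proof -
    have "Y n = (\<lambda>\<omega>. 1 * X n \<omega> + (-1) * (m n - M / N))" unfolding Y_def by (intro ext) simp
    then show ?thesis using L_lincomb[OF X[OF that] L_const] by (simp only:)
  qed
  have Yacc: "Y n \<in> group_acceptable P N V n" if n: "n \<in> {1..N}" for n
  proof -
    have "ereal (e / N) \<le> expect Q (Y n)" if Q: "Q \<in> V n" for Q
    proof -
      interpret Q: prob_space Q using Q V_ac[OF n] unfolding ac_prob_measures_def by auto
      obtain z where z: "z \<in> densities P (V n)" "density P (\<lambda>\<omega>. ennreal (z \<omega>)) = Q"
        using density_exists[OF Q V_ac[OF n]] .
      have "m n \<le> J n z" unfolding m_def using z(1) bdd[OF n] by (intro cInf_lower) auto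
      also have "J n z = (\<integral>\<omega>. X n \<omega> \<partial>Q)"
        using integral_wrt_density(2)[OF z(1) V_ac[OF n] L_D[OF X[OF n] n]] unfolding z(2) J_def by simp
      finally have "M / N \<le> (\<integral>\<omega>. Y n \<omega> \<partial>Q)"
        unfolding Y_def using L_integrable[OF X[OF n] n Q] by (simp add: Q.prob_space)
      moreover have "e / N \<le> M / N" using \<open>e \<le> M\<close> by (simp add: divide_right_mono)
      ultimately show ?thesis
        unfolding expect_eq_integral[OF L_integrable[OF YL[OF n] n Q]] by simp
    qed
    then have "ereal (e / N) \<le> (INF Q\<in>V n. expect Q (Y n))" by (intro INF_greatest)
    moreover have "0 < ereal (e / N)" using e N_pos by simp
    ultimately have "0 < (INF Q\<in>V n. expect Q (Y n))" by (rule less_le_trans[rotated])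
    then show ?thesis unfolding group_acceptable_def using YL[OF n] by blast
  qed
  have Ysum: "(\<Sum>n=1..N. Y n \<omega>) = (\<Sum>n=1..N. X n \<omega>)" for \<omega>
  proof -
    have "(\<Sum>n=1..N. m n - M / N) = 0" using N_pos by (simp add: sum_subtractf M_def)
    moreover have "(\<Sum>n=1..N. Y n \<omega>) = (\<Sum>n=1..N. X n \<omega>) - (\<Sum>n=1..N. m n - M / N)"
      unfolding Y_def by (rule sum_subtractf)
    ultimately show ?thesis by linarith
  qed
  show ?thesis by (rule acceptableI[OF sumL Yacc Ysum])
qed

definition profile_distance :: "(nat \<Rightarrow> 'a \<Rightarrow> real) \<Rightarrow> (nat \<Rightarrow> 'a \<Rightarrow> real) \<Rightarrow> real" where
  "profile_distance z w = (\<Sum>n=1..N. \<integral>\<omega>. \<bar>z n \<omega> - w n \<omega>\<bar> \<partial>P)"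

lemma profile_distance_nonneg: "0 \<le> profile_distance z w"
  unfolding profile_distance_def by (intro sum_nonneg) simp

lemma component_le_profile_distance: "n \<in> {1..N} \<Longrightarrow> (\<integral>\<omega>. \<bar>z n \<omega> - w n \<omega>\<bar> \<partial>P) \<le> profile_distance z w"
  unfolding profile_distance_def by (intro member_le_sum) auto

lemma profile_integrable: "z \<in> profiles \<Longrightarrow> n \<in> {1..N} \<Longrightarrow> integrable P (z n)"
  using densitiesD(1)[OF profilesD] by blast

lemma profile_distance_triangle:
  assumes "x \<in> profiles" "y \<in> profiles" "z \<in> profiles"
  shows "profile_distance x z \<le> profile_distance x y + profile_distance y z"
proof -
  have "(\<integral>\<omega>. \<bar>x n \<omega> - z n \<omega>\<bar> \<partial>P) \<le> (\<integral>\<omega>. \<bar>x n \<omega> - y n \<omega>\<bar> \<partial>P) + (\<integral>\<omega>. \<bar>y n \<omega> - z n \<omega>\<bar> \<partial>P)"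
    if n: "n \<in> {1..N}" for n
  proof -
    note I = assms[THEN profile_integrable, OF n]
    have "(\<integral>\<omega>. \<bar>x n \<omega> - z n \<omega>\<bar> \<partial>P) \<le> (\<integral>\<omega>. \<bar>x n \<omega> - y n \<omega>\<bar> + \<bar>y n \<omega> - z n \<omega>\<bar> \<partial>P)"
      using I by (intro integral_mono) auto
    then show ?thesis using I by simp
  qed
  then show ?thesis unfolding profile_distance_def sum.distrib[symmetric] by (intro sum_mono)
qed

lemma profiles_complete:
  assumes zs: "\<forall>k::nat. zs k \<in> profiles"
    and cauchy: "\<forall>e>0. \<exists>k. \<forall>i\<ge>k. \<forall>j\<ge>k. profile_distance (zs i) (zs j) < e"
  shows "\<exists>z\<in>profiles. (\<lambda>k. profile_distance (zs k) z) \<longlonglongrightarrow> 0"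
proof -
  have "\<exists>w. integrable P w \<and> (\<lambda>k. \<integral>\<omega>. \<bar>zs k n \<omega> - w \<omega>\<bar> \<partial>P) \<longlonglongrightarrow> 0" if n: "n \<in> {1..N}" for n
  proof (rule L1_complete)
    show "integrable P (zs k n)" for k using profile_integrable[OF _ n] zs by blast
    show "\<exists>k. \<forall>i\<ge>k. \<forall>j\<ge>k. (\<integral>\<omega>. \<bar>zs i n \<omega> - zs j n \<omega>\<bar> \<partial>P) < e" if "0 < e" for e
      using cauchy that component_le_profile_distance[OF n] by (meson le_less_trans)
  qed
  then have "\<forall>n. \<exists>w. n \<in> {1..N} \<longrightarrow> integrable P w \<and> (\<lambda>k. \<integral>\<omega>. \<bar>zs k n \<omega> - w \<omega>\<bar> \<partial>P) \<longlonglongrightarrow> 0" by blast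
  then obtain z where z: "\<And>n. n \<in> {1..N} \<Longrightarrow> integrable P (z n)"
      "\<And>n. n \<in> {1..N} \<Longrightarrow> (\<lambda>k. \<integral>\<omega>. \<bar>zs k n \<omega> - z n \<omega>\<bar> \<partial>P) \<longlonglongrightarrow> 0" by metis
  have "z n \<in> densities P (V n)" if n: "n \<in> {1..N}" for n
    using V_closed[OF n] z(1,2)[OF n] zs profilesD[OF _ n] unfolding L1_closed_def
    by (elim allE[of _ "\<lambda>k. zs k n"]) blast
  then have "z \<in> profiles" unfolding profiles_def by blast
  moreover have "(\<lambda>k. profile_distance (zs k) z) \<longlonglongrightarrow> 0"
    unfolding profile_distance_def using tendsto_sum[of "{1..N}", OF z(2)] by simp
  ultimately show ?thesis by blast
qed

lemma total_expectation_tendsto: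
  assumes X: "\<And>n. n \<in> {1..N} \<Longrightarrow> X n \<in> L" and zs: "\<forall>k::nat. zs k \<in> profiles" and z: "z \<in> profiles"
    and conv: "(\<lambda>k. profile_distance (zs k) z) \<longlonglongrightarrow> 0"
  shows "(\<lambda>k. total_expectation X (zs k)) \<longlonglongrightarrow> total_expectation X z"
  unfolding total_expectation_def
proof (rule tendsto_sum)
  fix n assume n: "n \<in> {1..N}"
  have "(\<lambda>k. \<integral>\<omega>. \<bar>zs k n \<omega> - z n \<omega>\<bar> \<partial>P) \<longlonglongrightarrow> 0"
    by (rule tendsto_sandwich[OF _ _ tendsto_const conv]) (use component_le_profile_distance[OF n] in auto)
  then show "(\<lambda>k. \<integral>\<omega>. zs k n \<omega> * X n \<omega> \<partial>P) \<longlonglongrightarrow> (\<integral>\<omega>. z n \<omega> * X n \<omega> \<partial>P)"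
    using zs z by (intro integral_wrt_density_tendsto[OF _ _ V_ac[OF n] L_D[OF X[OF n] n]] profilesD[OF _ n]) auto
qed

definition total_gauge :: "(nat \<Rightarrow> 'a \<Rightarrow> real) \<Rightarrow> real" where
  "total_gauge z = (\<Sum>n=1..N. reciprocal_gauge P (z n))"

definition profile_midpoint :: "(nat \<Rightarrow> 'a \<Rightarrow> real) \<Rightarrow> (nat \<Rightarrow> 'a \<Rightarrow> real) \<Rightarrow> nat \<Rightarrow> 'a \<Rightarrow> real" where
  "profile_midpoint z w = (\<lambda>n \<omega>. (1/2) * z n \<omega> + (1/2) * w n \<omega>)"

text \<open>Uniform integrability of the \<open>N\<close> sets of densities supplies one truncation level \<open>k\<close> that serves all of them,
so the constants in \<open>L1_distance_le_gauge_gap\<close> do not depend on the tuples.\<close>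

lemma total_gauge_uniformly_convex:
  assumes "0 < e"
  shows "\<exists>r>0. \<forall>z\<in>profiles. \<forall>w\<in>profiles.
    (total_gauge z + total_gauge w) / 2 - total_gauge (profile_midpoint z w) \<le> r \<longrightarrow> profile_distance z w < e"
proof -
  \<comment> \<open>The estimate below is \<open>3 N h + h \<le> 4 N h = e / 2\<close>.\<close>
  define h where "h = e / (8 * N)"
  have h: "0 < h" "real N * h = e / 8" unfolding h_def using assms N_pos by auto
  have "\<forall>n. \<exists>k0. n \<in> {1..N} \<longrightarrow> (\<forall>k\<ge>k0. \<forall>z\<in>densities P (V n). tail_expectation P z k \<le> ennreal h)"
    using V_ui h(1) unfolding uniformly_integrable_iff by blast
  then obtain kf where kf: "\<And>n k z. n \<in> {1..N} \<Longrightarrow> kf n \<le> k \<Longrightarrow> z \<in> densities P (V n) \<Longrightarrow> tail_expectation P z k \<le> ennreal h"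
    by metis
  define k where "k = (\<Sum>n=1..N. \<bar>kf n\<bar>)"
  have k0: "0 \<le> k" unfolding k_def by (intro sum_nonneg) auto
  have kle: "kf n \<le> k" if "n \<in> {1..N}" for n
    using member_le_sum[of n "{1..N}" "\<lambda>n. \<bar>kf n\<bar>"] that unfolding k_def by auto
  define c where "c = 4 * (1 + k)^3 / h"
  have c: "0 < c" unfolding c_def using h k0 by simp
  have "profile_distance z w < e" if z: "z \<in> profiles" and w: "w \<in> profiles"
    and gap: "(total_gauge z + total_gauge w) / 2 - total_gauge (profile_midpoint z w) \<le> h / c" for z w
  proof -
    let ?g = "\<lambda>n. (reciprocal_gauge P (z n) + reciprocal_gauge P (w n)) / 2 - reciprocal_gauge P (profile_midpoint z w n)"
    have "(\<integral>\<omega>. \<bar>z n \<omega> - w n \<omega>\<bar> \<partial>P) \<le> 3 * h + c * ?g n" if n: "n \<in> {1..N}" for n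
    proof -
      have "profile_midpoint z w n = (\<lambda>\<omega>. (z n \<omega> + w n \<omega>) / 2)"
        unfolding profile_midpoint_def by (simp add: add_divide_distrib)
      then show ?thesis
        using L1_distance_le_gauge_gap[OF densitiesD(1,2)[OF profilesD[OF z n]] densitiesD(1,2)[OF profilesD[OF w n]]
            h(1) k0 kf[OF n kle[OF n] profilesD[OF z n]] kf[OF n kle[OF n] profilesD[OF w n]]]
        unfolding c_def by simp
    qed
    then have "profile_distance z w \<le> (\<Sum>n=1..N. 3 * h + c * ?g n)" unfolding profile_distance_def by (intro sum_mono)
    also have "\<dots> = 3 * (real N * h) + c * (\<Sum>n=1..N. ?g n)"
      by (simp add: sum.distrib sum_distrib_left)
    also have "(\<Sum>n=1..N. ?g n) = (total_gauge z + total_gauge w) / 2 - total_gauge (profile_midpoint z w)"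
      unfolding total_gauge_def by (simp add: sum_subtractf sum.distrib sum_divide_distrib[symmetric])
    also have "3 * (real N * h) + c * \<dots> \<le> 3 * (real N * h) + c * (h / c)"
      using gap c by (intro add_left_mono mult_left_mono) auto
    also have "\<dots> = 3 * (e / 8) + h" unfolding h(2) using c by simp
    also have "h \<le> real N * h" using h(1) N_pos by simp
    finally show ?thesis using h assms by simp
  qed
  moreover have "0 < h / c" using h c by simp
  ultimately show ?thesis by blast
qed

lemma total_gauge_bounds:
  assumes "z \<in> profiles"
  shows "0 \<le> total_gauge z" "total_gauge z \<le> N"
proof -
  have b: "0 \<le> reciprocal_gauge P (z n)" "reciprocal_gauge P (z n) \<le> 1" if "n \<in> {1..N}" for n
    using reciprocal_gauge_bounds[OF densitiesD(4)[OF profilesD[OF assms that]]] by auto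
  show "0 \<le> total_gauge z" unfolding total_gauge_def using b by (intro sum_nonneg)
  have "total_gauge z \<le> (\<Sum>n=1..N. 1)" unfolding total_gauge_def using b by (intro sum_mono)
  then show "total_gauge z \<le> N" by simp
qed

text \<open>The ways to split a position of \<open>B\<close> among the groups.  The sum is required pointwise, not almost everywhere, so
that it is itself an element of \<open>B\<close>.\<close>

section \<open>Separation by a common measure\<close>

definition decompositions :: "('a \<Rightarrow> real) set \<Rightarrow> (nat \<Rightarrow> 'a \<Rightarrow> real) set" where
  "decompositions B = {X. (\<forall>n\<in>{1..N}. X n \<in> L) \<and> (\<lambda>\<omega>. \<Sum>n=1..N. X n \<omega>) \<in> B}"

text \<open>The constraints are relaxed to \<open>g \<le> e\<close> with \<open>e > 0\<close>.  If finitely many of them excluded every tuple of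
densities, \<open>finite_minimax\<close> would produce one decomposition with expectations bounded below by \<open>e / 2\<close>, hence an
acceptable element of \<open>B\<close>.  So the relaxed constraints have the finite intersection property and a common solution.\<close>

lemma common_profile:
  assumes BL: "B \<subseteq> L" and ne: "B \<noteq> {}" and cvx: "convex_rvs B" and not_acc: "B \<inter> acceptable P N V = {}"
  shows "\<exists>z\<in>profiles. \<forall>X\<in>decompositions B. total_expectation X z \<le> 0"
proof -
  define G where "G = total_expectation ` decompositions B"
  have DL: "X n \<in> L" if "X \<in> decompositions B" "n \<in> {1..N}" for X n
    using that unfolding decompositions_def by auto
  obtain b where b: "b \<in> B" using ne by blast
  have "(\<lambda>n. if n = 1 then b else (\<lambda>_. 0)) \<in> decompositions B"
  proof -
    have "(\<lambda>\<omega>. \<Sum>n=1..N. (if n = 1 then b else (\<lambda>_. 0)) \<omega>) = b"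
    proof
      fix \<omega>
      have "(\<Sum>n=1..N. (if n = 1 then b else (\<lambda>_. 0)) \<omega>) = (\<Sum>n=1..N. if n = 1 then b \<omega> else 0)"
        by (intro sum.cong) auto
      then show "(\<Sum>n=1..N. (if n = 1 then b else (\<lambda>_. 0)) \<omega>) = b \<omega>" using N_pos by simp
    qed
    then show ?thesis unfolding decompositions_def using b BL L_const by auto
  qed
  then have Gne: "G \<noteq> {}" unfolding G_def by blast
  have finite_approx: "\<exists>z\<in>profiles. \<forall>g\<in>S. g z \<le> e" if S: "finite S" "S \<subseteq> G" and e: "0 < e" for S e
  proof (rule ccontr)
    assume "\<not> ?thesis"
    then have neg: "\<exists>g\<in>S. e < g z" if "z \<in> profiles" for z using that by (meson not_less)
    have "\<exists>h\<in>G. \<forall>z\<in>profiles. e / 2 \<le> h z"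
    proof (rule finite_minimax[OF S Gne _ _ neg])
      show "\<exists>y\<in>profiles. \<forall>g\<in>G. g y = u * g z + v * g w"
        if "z \<in> profiles" "w \<in> profiles" "0 \<le> u" "0 \<le> v" "u + v = 1" for z w u v
        using profiles_mix[OF that] total_expectation_mix[OF that(1,2)] DL unfolding G_def by blast
      show "\<exists>h\<in>G. \<forall>z\<in>profiles. h z = u * f z + v * g z"
        if fg: "f \<in> G" "g \<in> G" and uv: "0 \<le> u" "0 \<le> v" "u + v = 1" for f g u v
      proof -
        obtain X Y where XY: "X \<in> decompositions B" "Y \<in> decompositions B" "f = total_expectation X" "g = total_expectation Y"
          using fg unfolding G_def by blast
        have "(\<lambda>n \<omega>. u * X n \<omega> + v * Y n \<omega>) \<in> decompositions B"
          using XY(1,2) cvx uv L_lincomb unfolding decompositions_def convex_rvs_def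
          by (auto simp: sum.distrib sum_distrib_left[symmetric])
        then show ?thesis using total_expectation_lincomb[of _ X Y u v] DL XY unfolding G_def by blast
      qed
      show "e / 2 < e" using e by simp
    qed
    then obtain X where X: "X \<in> decompositions B" "\<And>z. z \<in> profiles \<Longrightarrow> e / 2 \<le> total_expectation X z"
      unfolding G_def by blast
    have "(\<lambda>\<omega>. \<Sum>n=1..N. X n \<omega>) \<in> B" using X(1) unfolding decompositions_def by simp
    moreover have "(\<lambda>\<omega>. \<Sum>n=1..N. X n \<omega>) \<in> acceptable P N V"
      using acceptable_if_total_expectation_bounded_below[of X "e / 2"] DL[OF X(1)] calculation BL e X(2) by auto
    ultimately show False using not_acc by blast
  qed
  define \<C> where "\<C> = (\<lambda>(g, e). {z. g z \<le> e}) ` (G \<times> {0::real<..})"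
  have "\<exists>z\<in>profiles. \<forall>C\<in>\<C>. z \<in> C"
  proof (rule convex_gauge_finite_intersection[where d = profile_distance and \<Phi> = total_gauge and mid = profile_midpoint and b = "real N"])
    show "profile_midpoint z w \<in> profiles" if "z \<in> profiles" "w \<in> profiles" for z w
      unfolding profile_midpoint_def by (rule profiles_mix[OF that]) simp_all
    fix C assume "C \<in> \<C>"
    then obtain X e where X: "X \<in> decompositions B" and C: "C = {z. total_expectation X z \<le> e}"
      unfolding \<C>_def G_def by auto
    show "profile_midpoint z w \<in> C" if "z \<in> profiles \<inter> C" "w \<in> profiles \<inter> C" for z w
      using total_expectation_mix[of z w X "1/2" "1/2"] DL[OF X] that unfolding C profile_midpoint_def by auto
    show "z \<in> C" if "\<forall>k::nat. zs k \<in> profiles \<inter> C" "z \<in> profiles" "(\<lambda>k. profile_distance (zs k) z) \<longlonglongrightarrow> 0" for zs z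
      using LIMSEQ_le_const2[OF total_expectation_tendsto[of X zs z]] DL[OF X] that unfolding C by auto
  next
    fix \<S> assume "finite \<S>" "\<S> \<subseteq> \<C>"
    then obtain T where T: "finite T" "T \<subseteq> G \<times> {0::real<..}" "\<S> = (\<lambda>(g, e). {z. g z \<le> e}) ` T"
      unfolding \<C>_def by (meson finite_subset_image)
    define e where "e = Min (insert 1 (snd ` T))"
    have "0 < e" unfolding e_def using T by (subst Min_gr_iff) auto
    moreover have "finite (fst ` T)" "fst ` T \<subseteq> G" using T by auto
    ultimately obtain z where z: "z \<in> profiles" "\<forall>g\<in>fst ` T. g z \<le> e" using finite_approx by blast
    have "g z \<le> e'" if t: "(g, e') \<in> T" for g e'
    proof -
      have "e' \<in> snd ` T" "g \<in> fst ` T" using t by force+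
      then have "e \<le> e'" unfolding e_def using T(1) by (intro Min_le) auto
      then show ?thesis using z(2) \<open>g \<in> fst ` T\<close> by (blast intro: order_trans)
    qed
    then show "profiles \<inter> \<Inter>\<S> \<noteq> {}" using z(1) unfolding T(3) by auto
  next
    show "0 \<le> profile_distance x y" for x y by (rule profile_distance_nonneg)
    show "profile_distance x z \<le> profile_distance x y + profile_distance y z"
      if "x \<in> profiles" "y \<in> profiles" "z \<in> profiles" for x y z by (rule profile_distance_triangle[OF that])
    show "\<exists>z\<in>profiles. (\<lambda>k. profile_distance (zs k) z) \<longlonglongrightarrow> 0"
      if "\<forall>k::nat. zs k \<in> profiles" "\<forall>e>0. \<exists>k. \<forall>i\<ge>k. \<forall>j\<ge>k. profile_distance (zs i) (zs j) < e" for zs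
      by (rule profiles_complete[OF that])
    show "0 \<le> total_gauge z" "total_gauge z \<le> real N" if "z \<in> profiles" for z
      by (rule total_gauge_bounds[OF that])+
    show "\<exists>r>0. \<forall>z\<in>profiles. \<forall>w\<in>profiles.
        (total_gauge z + total_gauge w) / 2 - total_gauge (profile_midpoint z w) \<le> r \<longrightarrow> profile_distance z w < e"
      if "0 < e" for e by (rule total_gauge_uniformly_convex[OF that])
  qed
  then obtain z where z: "z \<in> profiles" "\<And>g e. g \<in> G \<Longrightarrow> 0 < e \<Longrightarrow> g z \<le> e"
    unfolding \<C>_def by (auto simp: image_iff)
  have "g z \<le> 0" if g: "g \<in> G" for g
  proof (rule field_le_epsilon)
    show "g z \<le> 0 + e" if "0 < e" for e using z(2)[OF g that] by simp
  qed
  then show ?thesis using z(1) unfolding G_def by blast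
qed

text \<open>The tuple from \<open>common_profile\<close> consists of densities of a single measure: exchanging \<open>t\<close> times the indicator of
\<open>E\<close> between two groups changes the total expectation by \<open>t a\<close>, where \<open>a\<close> is the difference of the
probabilities that the two densities give to \<open>E\<close>, and boundedness from above for all real \<open>t\<close> forces \<open>a = 0\<close>.\<close>

theorem no_acceptable_imp_common_measure:
  assumes BL: "B \<subseteq> L" and ne: "B \<noteq> {}" and cvx: "convex_rvs B" and not_acc: "B \<inter> acceptable P N V = {}"
  shows "\<exists>Q\<in>(\<Inter>n\<in>{1..N}. V n). \<forall>X\<in>B. (\<integral>\<omega>. X \<omega> \<partial>Q) \<le> 0"
proof -
  obtain z where z: "z \<in> profiles" "\<And>X. X \<in> decompositions B \<Longrightarrow> total_expectation X z \<le> 0"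
    using common_profile[OF assms] by blast
  have one: "1 \<in> {1..N}" using N_pos by simp
  define solo where "solo X = (\<lambda>n. if n = (1::nat) then X else (\<lambda>_. 0::real))" for X :: "'a \<Rightarrow> real"
  have soloL: "solo X n \<in> L" if "X \<in> L" for X n unfolding solo_def using that L_const by simp
  have solo_sum: "(\<Sum>n=1..N. solo X n \<omega>) = X \<omega>" for X \<omega>
  proof -
    have "(\<Sum>n=1..N. solo X n \<omega>) = (\<Sum>n=1..N. if n = 1 then X \<omega> else 0)"
      unfolding solo_def by (intro sum.cong) auto
    then show ?thesis using N_pos by simp
  qed
  have solo_pair: "total_expectation (solo X) z = (\<integral>\<omega>. z 1 \<omega> * X \<omega> \<partial>P)" for X
  proof -
    have "total_expectation (solo X) z = (\<Sum>n=1..N. if n = 1 then \<integral>\<omega>. z 1 \<omega> * X \<omega> \<partial>P else 0)"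
      unfolding total_expectation_def solo_def by (intro sum.cong) auto
    then show ?thesis using N_pos by simp
  qed
  obtain b where b: "b \<in> B" using ne by blast
  then have bL: "b \<in> L" using BL by blast
  have same: "(\<integral>\<omega>. z n \<omega> * indicator E \<omega> \<partial>P) = (\<integral>\<omega>. z 1 \<omega> * indicator E \<omega> \<partial>P)"
    if n: "n \<in> {1..N}" and E: "E \<in> sets P" for n E
  proof (cases "n = 1")
    case False
    define W where "W i \<omega> = (if i = n then indicator E \<omega> else if i = 1 then - indicator E \<omega> else 0 :: real)" for i \<omega>
    define a where "a = (\<integral>\<omega>. z n \<omega> * indicator E \<omega> \<partial>P) - (\<integral>\<omega>. z 1 \<omega> * indicator E \<omega> \<partial>P)"
    have WL: "W i \<in> L" for i
      unfolding W_def using E by (intro L_bounded[of _ 1]) (auto simp: indicator_def)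
    have split: "(\<Sum>i=1..N. f i) = f n + f 1" if "\<And>i. i \<noteq> n \<Longrightarrow> i \<noteq> 1 \<Longrightarrow> f i = 0" for f :: "nat \<Rightarrow> real"
    proof -
      have "(\<Sum>i=1..N. f i) = (\<Sum>i\<in>{n, 1}. f i)" using n one that by (intro sum.mono_neutral_right) auto
      then show ?thesis using False by simp
    qed
    have Wsum: "(\<Sum>i=1..N. W i \<omega>) = 0" for \<omega>
      using split[of "\<lambda>i. W i \<omega>"] False unfolding W_def by simp
    have Wpair: "total_expectation W z = a"
      unfolding total_expectation_def using False by (subst split) (auto simp: W_def a_def)
    have t: "total_expectation (solo b) z + t * a \<le> 0" for t
    proof -
      have "(\<lambda>i \<omega>. 1 * solo b i \<omega> + t * W i \<omega>) \<in> decompositions B"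
        unfolding decompositions_def using L_lincomb[OF soloL[OF bL] WL, of 1 _ t] b
        by (simp add: sum.distrib solo_sum sum_distrib_left[symmetric] Wsum del: One_nat_def)
      from z(2)[OF this] show ?thesis
        using total_expectation_lincomb[OF z(1), of "solo b" W 1 t] soloL[OF bL] WL Wpair by simp
    qed
    have "a = 0"
    proof (rule ccontr)
      assume "a \<noteq> 0"
      then show False using t[of "(1 - total_expectation (solo b) z) / a"] by simp
    qed
    then show ?thesis unfolding a_def by simp
  qed simp
  define Q where "Q = density P (\<lambda>\<omega>. ennreal (z 1 \<omega>))"
  have "density P (\<lambda>\<omega>. ennreal (z n \<omega>)) = Q" if n: "n \<in> {1..N}" for n
  proof (rule measure_eqI)
    fix E assume "E \<in> sets (density P (\<lambda>\<omega>. ennreal (z n \<omega>)))"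
    then have E: "E \<in> sets P" by simp
    have em: "emeasure (density P (\<lambda>\<omega>. ennreal (z i \<omega>))) E = ennreal (\<integral>\<omega>. z i \<omega> * indicator E \<omega> \<partial>P)"
      if i: "i \<in> {1..N}" for i
    proof -
      note zi = densitiesD[OF profilesD[OF z(1) i]]
      have "emeasure (density P (\<lambda>\<omega>. ennreal (z i \<omega>))) E = (\<integral>\<^sup>+\<omega>. ennreal (z i \<omega> * indicator E \<omega>) \<partial>P)"
        using zi(4) E by (subst emeasure_density) (auto intro!: nn_integral_cong simp: indicator_def)
      also have "\<dots> = ennreal (\<integral>\<omega>. z i \<omega> * indicator E \<omega> \<partial>P)"
        using zi(1,2) E by (intro nn_integral_eq_integral integrable_real_mult_indicator) auto
      finally show ?thesis .
    qed
    show "emeasure (density P (\<lambda>\<omega>. ennreal (z n \<omega>))) E = emeasure Q E"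
      unfolding Q_def em[OF n] em[OF one] same[OF n E] ..
  qed (simp add: Q_def)
  then have "Q \<in> V n" if "n \<in> {1..N}" for n
    using densitiesD(3)[OF profilesD[OF z(1) that]] that by simp
  moreover have "(\<integral>\<omega>. X \<omega> \<partial>Q) \<le> 0" if X: "X \<in> B" for X
  proof -
    have XL: "X \<in> L" using X BL by blast
    have "solo X \<in> decompositions B" unfolding decompositions_def using soloL[OF XL] X by (simp add: solo_sum del: One_nat_def)
    then have "(\<integral>\<omega>. z 1 \<omega> * X \<omega> \<partial>P) \<le> 0" using z(2) solo_pair by metis
    then show ?thesis unfolding Q_def
      using integral_wrt_density(2)[OF profilesD[OF z(1) one] V_ac[OF one] L_D[OF XL one]] by simp
  qed
  ultimately show ?thesis by blast
qed

section \<open>Prices\<close>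

text \<open>A decomposition of an acceptable position is only required to hold \<open>P\<close>-almost everywhere; it holds
\<open>Q\<close>-almost everywhere by absolute continuity.\<close>

lemma integral_acceptable_pos:
  assumes X: "X \<in> acceptable P N V" and Q: "Q \<in> (\<Inter>n\<in>{1..N}. V n)"
  shows "0 < (\<integral>\<omega>. X \<omega> \<partial>Q)"
proof -
  obtain Xs where Xs: "AE \<omega> in P. (\<Sum>n=1..N. Xs n \<omega>) = X \<omega>"
      "\<And>n. n \<in> {1..N} \<Longrightarrow> Xs n \<in> group_acceptable P N V n"
    using X unfolding acceptable_def by auto
  have XsL: "Xs n \<in> L" if "n \<in> {1..N}" for n using Xs(2)[OF that] unfolding group_acceptable_def by auto
  have QV: "Q \<in> V n" if "n \<in> {1..N}" for n using Q that by blast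
  have int: "integrable Q (Xs n)" if "n \<in> {1..N}" for n using L_integrable[OF XsL[OF that] that QV[OF that]] .
  have pos: "0 < (\<integral>\<omega>. Xs n \<omega> \<partial>Q)" if n: "n \<in> {1..N}" for n
  proof -
    have "0 < (INF Q\<in>V n. expect Q (Xs n))" using Xs(2)[OF n] unfolding group_acceptable_def by simp
    also have "\<dots> \<le> expect Q (Xs n)" using QV[OF n] by (rule INF_lower)
    finally show ?thesis unfolding expect_eq_integral[OF int[OF n]] by simp
  qed
  have Q_ac: "absolutely_continuous P Q" "sets Q = sets P"
    using QV[of 1] V_ac[of 1] N_pos unfolding ac_prob_measures_def by auto
  have "AE \<omega> in Q. (\<Sum>n=1..N. Xs n \<omega>) = X \<omega>"
    using absolutely_continuous_AE[OF Q_ac(2,1) Xs(1)] .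
  moreover have "X \<in> borel_measurable Q"
    using X L_measurable measurable_cong_sets[OF Q_ac(2) refl] unfolding acceptable_def by auto
  moreover have "(\<lambda>\<omega>. \<Sum>n=1..N. Xs n \<omega>) \<in> borel_measurable Q"
    using int by (intro borel_measurable_sum) auto
  ultimately have "(\<integral>\<omega>. X \<omega> \<partial>Q) = (\<integral>\<omega>. (\<Sum>n=1..N. Xs n \<omega>) \<partial>Q)"
    by (intro integral_cong_AE) auto
  also have "\<dots> = (\<Sum>n=1..N. \<integral>\<omega>. Xs n \<omega> \<partial>Q)" using int by (intro Bochner_Integration.integral_sum) auto
  also have "\<dots> > 0" using pos N_pos by (intro sum_pos) auto
  finally show ?thesis .
qed

lemma common_measure_D:
  assumes Q: "Q \<in> (\<Inter>n\<in>{1..N}. V n)" and X: "X \<in> L"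
  shows "prob_space Q" "integrable Q X" "expect Q X = ereal (\<integral>\<omega>. X \<omega> \<partial>Q)" "Q \<in> ac_prob_measures P"
proof -
  have Q1: "Q \<in> V 1" using Q N_pos by auto
  then show "Q \<in> ac_prob_measures P" using V_ac[of 1] N_pos by auto
  then show "prob_space Q" unfolding ac_prob_measures_def by simp
  show "integrable Q X" using L_integrable[OF X _ Q1] N_pos by simp
  then show "expect Q X = ereal (\<integral>\<omega>. X \<omega> \<partial>Q)" by (rule expect_eq_integral)
qed

text \<open>The argument also covers an empty set of measures on the right, where the supremum is \<open>-\<infinity>\<close>: each real
number below the upper price would produce an element of that set.\<close>

lemma upper_price_dual:
  assumes AL: "A \<subseteq> L" and ne: "A \<noteq> {}" and cvx: "convex_rvs A" and cone: "cone_rvs A" and F: "F \<in> L"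
  shows "upper_price P N V A F = (SUP Q \<in> (\<Inter>n\<in>{1..N}. V n) \<inter> risk_neutral P A. expect Q F)"
    (is "_ = ?S")
proof (rule antisym)
  show "?S \<le> upper_price P N V A F"
    unfolding upper_price_def
  proof (rule SUP_least, rule Inf_greatest)
    fix Q y
    assume Q: "Q \<in> (\<Inter>n\<in>{1..N}. V n) \<inter> risk_neutral P A"
      and "y \<in> {ereal x |x. \<exists>X\<in>A. (\<lambda>\<omega>. X \<omega> - F \<omega> + x) \<in> acceptable P N V}"
    then obtain x X where x: "y = ereal x" and X: "X \<in> A" "(\<lambda>\<omega>. X \<omega> - F \<omega> + x) \<in> acceptable P N V" by blast
    have QV: "Q \<in> (\<Inter>n\<in>{1..N}. V n)" using Q by blast
    have XL: "X \<in> L" using X AL by blast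
    interpret Q: prob_space Q using common_measure_D(1)[OF QV F] .
    note I = common_measure_D(2)[OF QV F] common_measure_D(2)[OF QV XL]
    have "expect Q X \<le> 0" using Q X(1) unfolding risk_neutral_def by blast
    then have "(\<integral>\<omega>. X \<omega> \<partial>Q) \<le> 0" using common_measure_D(3)[OF QV XL] by simp
    moreover have "0 < (\<integral>\<omega>. X \<omega> - F \<omega> + x \<partial>Q)" using integral_acceptable_pos[OF X(2) QV] .
    then have "0 < (\<integral>\<omega>. X \<omega> \<partial>Q) - (\<integral>\<omega>. F \<omega> \<partial>Q) + x" using I by (simp add: Q.prob_space)
    ultimately show "expect Q F \<le> y" using common_measure_D(3)[OF QV F] x by simp
  qed
next
  show "upper_price P N V A F \<le> ?S"
  proof (rule ccontr)
    assume "\<not> ?thesis"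
    then obtain x where x: "?S < ereal x" "ereal x < upper_price P N V A F"
      using ereal_dense2 by (meson not_le)
    define B where "B = (\<lambda>X \<omega>. X \<omega> - F \<omega> + x) ` A"
    have B_I: "(\<lambda>\<omega>. X \<omega> - F \<omega> + x) \<in> B" if "X \<in> A" for X
      unfolding B_def by (rule imageI[OF that])
    have "\<not> (\<exists>X\<in>A. (\<lambda>\<omega>. X \<omega> - F \<omega> + x) \<in> acceptable P N V)"
    proof
      assume "\<exists>X\<in>A. (\<lambda>\<omega>. X \<omega> - F \<omega> + x) \<in> acceptable P N V"
      then have "upper_price P N V A F \<le> ereal x" unfolding upper_price_def by (intro Inf_lower) blast
      then show False using x(2) by simp
    qed
    then have "B \<inter> acceptable P N V = {}" unfolding B_def by blast
    moreover have "B \<subseteq> L"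
    proof
      fix Y assume "Y \<in> B"
      then obtain X where X: "X \<in> A" "Y = (\<lambda>\<omega>. X \<omega> - F \<omega> + x)" unfolding B_def by blast
      have "(\<lambda>\<omega>. 1 * X \<omega> + 1 * ((-1) * F \<omega> + 1 * x)) \<in> L"
        using X(1) AL F by (intro L_lincomb L_const) auto
      then show "Y \<in> L" unfolding X(2) by (simp add: algebra_simps)
    qed
    moreover have "convex_rvs B"
      unfolding convex_rvs_def
    proof (intro ballI allI impI)
      fix Y1 Y2 and u v :: real
      assume "Y1 \<in> B" "Y2 \<in> B" and uv: "0 \<le> u" "0 \<le> v" "u + v = 1"
      then obtain X1 X2 where X: "X1 \<in> A" "X2 \<in> A" "Y1 = (\<lambda>\<omega>. X1 \<omega> - F \<omega> + x)" "Y2 = (\<lambda>\<omega>. X2 \<omega> - F \<omega> + x)"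
        unfolding B_def by blast
      have mix: "(\<lambda>\<omega>. u * X1 \<omega> + v * X2 \<omega>) \<in> A" using cvx X(1,2) uv unfolding convex_rvs_def by blast
      have "(\<lambda>\<omega>. u * Y1 \<omega> + v * Y2 \<omega>) = (\<lambda>\<omega>. (u * X1 \<omega> + v * X2 \<omega>) - F \<omega> + x)"
      proof
        fix \<omega>
        have "u * Y1 \<omega> + v * Y2 \<omega> = u * X1 \<omega> + v * X2 \<omega> - (u + v) * F \<omega> + (u + v) * x"
          unfolding X(3,4) by (simp add: algebra_simps)
        then show "u * Y1 \<omega> + v * Y2 \<omega> = (u * X1 \<omega> + v * X2 \<omega>) - F \<omega> + x" using uv by simp
      qed
      then show "(\<lambda>\<omega>. u * Y1 \<omega> + v * Y2 \<omega>) \<in> B" using B_I[OF mix] by (simp only:)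
    qed
    moreover have "B \<noteq> {}" unfolding B_def using ne by blast
    ultimately have "\<exists>Q\<in>(\<Inter>n\<in>{1..N}. V n). \<forall>Y\<in>B. (\<integral>\<omega>. Y \<omega> \<partial>Q) \<le> 0"
      by (intro no_acceptable_imp_common_measure)
    then obtain Q where Q: "Q \<in> (\<Inter>n\<in>{1..N}. V n)" "\<And>Y. Y \<in> B \<Longrightarrow> (\<integral>\<omega>. Y \<omega> \<partial>Q) \<le> 0"
      by (elim bexE) metis
    interpret Q: prob_space Q using common_measure_D(1)[OF Q(1) F] .
    note IF = common_measure_D(2)[OF Q(1) F]
    define f where "f = (\<integral>\<omega>. F \<omega> \<partial>Q)"
    have scaled: "c * (\<integral>\<omega>. X \<omega> \<partial>Q) - f + x \<le> 0" if X: "X \<in> A" and c: "0 < c" for X c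
    proof -
      have "(\<lambda>\<omega>. c * X \<omega>) \<in> A" using cone X c unfolding cone_rvs_def by blast
      then have "(\<lambda>\<omega>. c * X \<omega> - F \<omega> + x) \<in> B" by (rule B_I)
      then have "(\<integral>\<omega>. c * X \<omega> - F \<omega> + x \<partial>Q) \<le> 0" by (rule Q(2))
      moreover have "integrable Q X" using common_measure_D(2)[OF Q(1)] X AL by blast
      ultimately show ?thesis using IF unfolding f_def by (simp add: Q.prob_space)
    qed
    have nonpos: "(\<integral>\<omega>. X \<omega> \<partial>Q) \<le> 0" if X: "X \<in> A" for X
    proof (rule ccontr)
      let ?m = "\<integral>\<omega>. X \<omega> \<partial>Q"
      assume neg: "\<not> ?m \<le> 0"
      \<comment> \<open>A positive expectation would be scaled above every bound.\<close>
      have "(\<bar>f - x\<bar> + 1) / ?m * ?m - f + x \<le> 0" using neg by (intro scaled[OF X]) simp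
      then show False using neg by simp
    qed
    have "Q \<in> risk_neutral P A"
      unfolding risk_neutral_def using nonpos common_measure_D[OF Q(1)] AL F by auto
    then have "expect Q F \<le> ?S" using Q(1) by (intro SUP_upper) blast
    have "x \<le> f"
    proof (rule field_le_epsilon)
      fix r :: real assume r: "0 < r"
      obtain X where X: "X \<in> A" using ne by blast
      let ?m = "\<integral>\<omega>. X \<omega> \<partial>Q"
      \<comment> \<open>\<open>A\<close> need not contain \<open>0\<close>; a small multiple of any element takes its place.\<close>
      define c where "c = r / (\<bar>?m\<bar> + 1)"
      have "0 < c" unfolding c_def using r by simp
      have "c * \<bar>?m\<bar> \<le> c * (\<bar>?m\<bar> + 1)" using \<open>0 < c\<close> by (intro mult_left_mono) auto
      also have "\<dots> = r" unfolding c_def by simp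
      finally have "c * \<bar>?m\<bar> \<le> r" .
      moreover have "c * (- ?m) \<le> c * \<bar>?m\<bar>" using \<open>0 < c\<close> by (intro mult_left_mono) auto
      ultimately have "- (c * ?m) \<le> r" by simp
      then show "x \<le> f + r" using scaled[OF X \<open>0 < c\<close>] by linarith
    qed
    then have "ereal x \<le> expect Q F" unfolding common_measure_D(3)[OF Q(1) F] f_def by simp
    also note \<open>expect Q F \<le> ?S\<close>
    finally show False using x(1) by simp
  qed
qed

lemma lower_price_eq_upper: "lower_price P N V A F = - upper_price P N V A (\<lambda>\<omega>. - F \<omega>)"
proof -
  have "{ereal x |x. \<exists>X\<in>A. (\<lambda>\<omega>. X \<omega> + F \<omega> - x) \<in> acceptable P N V}
    = uminus ` {ereal x |x. \<exists>X\<in>A. (\<lambda>\<omega>. X \<omega> - - F \<omega> + x) \<in> acceptable P N V}" (is "?L = uminus ` ?U")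
  proof (intro set_eqI iffI)
    fix y assume "y \<in> ?L"
    then obtain x where "y = ereal x" "\<exists>X\<in>A. (\<lambda>\<omega>. X \<omega> + F \<omega> - x) \<in> acceptable P N V" by blast
    then have "y = - ereal (- x)" "ereal (- x) \<in> ?U" by auto
    then show "y \<in> uminus ` ?U" by blast
  next
    fix y assume "y \<in> uminus ` ?U"
    then obtain x where x: "y = ereal (- x)" "\<exists>X\<in>A. (\<lambda>\<omega>. X \<omega> + F \<omega> + x) \<in> acceptable P N V"
      by fastforce
    show "y \<in> ?L" by (rule CollectI, rule exI[of _ "- x"]) (simp add: x)
  qed
  then show ?thesis unfolding lower_price_def upper_price_def by (simp only: ereal_Sup_uminus_image_eq)
qed

lemma lower_price_dual:
  assumes AL: "A \<subseteq> L" and ne: "A \<noteq> {}" and cvx: "convex_rvs A" and cone: "cone_rvs A" and F: "F \<in> L"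
  shows "lower_price P N V A F = (INF Q \<in> (\<Inter>n\<in>{1..N}. V n) \<inter> risk_neutral P A. expect Q F)"
proof -
  let ?M = "(\<Inter>n\<in>{1..N}. V n) \<inter> risk_neutral P A"
  have F': "(\<lambda>\<omega>. - F \<omega>) \<in> L" using L_lincomb[OF F F, of "-1" 0] by simp
  have "expect Q (\<lambda>\<omega>. - F \<omega>) = - expect Q F" if "Q \<in> ?M" for Q
    using common_measure_D(3)[OF _ F] common_measure_D(3)[OF _ F'] that by auto
  then have "(SUP Q\<in>?M. expect Q (\<lambda>\<omega>. - F \<omega>)) = (SUP Q\<in>?M. - expect Q F)" by (intro SUP_cong) auto
  then show ?thesis
    unfolding lower_price_eq_upper upper_price_dual[OF AL ne cvx cone F']
    by (simp add: ereal_SUP_uminus_eq)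
qed

end

theorem theorem5p4:
  fixes P :: "'a measure" and N :: nat and V :: "nat \<Rightarrow> 'a measure set"
    and A :: "('a \<Rightarrow> real) set" and F :: "'a \<Rightarrow> real"
  assumes "prob_space P"
    and "N \<ge> 1"
    and "\<And>n. n \<in> {1..N} \<Longrightarrow> V n \<subseteq> ac_prob_measures P"
    and "\<And>n. n \<in> {1..N} \<Longrightarrow> V n \<noteq> {}"
    and "\<And>n. n \<in> {1..N} \<Longrightarrow> convex_rvs (densities P (V n))"
    and "\<And>n. n \<in> {1..N} \<Longrightarrow> L1_closed P (densities P (V n))"
    and "\<And>n. n \<in> {1..N} \<Longrightarrow> uniformly_integrable P (densities P (V n))"
    and "A \<subseteq> Ls1 P N V" and "A \<noteq> {}" and "convex_rvs A" and "cone_rvs A"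
    and "F \<in> Ls1 P N V"
  shows "upper_price P N V A F = (SUP Q \<in> (\<Inter>n\<in>{1..N}. V n) \<inter> risk_neutral P A. expect Q F) \<and>
         lower_price P N V A F = (INF Q \<in> (\<Inter>n\<in>{1..N}. V n) \<inter> risk_neutral P A. expect Q F)"
proof -
  interpret valuation_groups P N V
    by (intro valuation_groups.intro valuation_groups_axioms.intro) (fact assms)+
  show ?thesis using upper_price_dual lower_price_dual assms(8-12) by blast
qed

end
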